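(* Assume $\operatorname{dom}J=\mathcal H^J_{\mathrm{har}}\oplus\ker J$ (direct sum of vector spaces). Then the trace form $\check{\mathcal E}$ coincides with the closure of the regular part of $\mathcal E_{\mathrm{har}}$.
   Context: Let $\mathcal H,\mathcal H_{\mathrm{aux}}$ be Hilbert spaces. Let $\mathcal E$ be a closed positive (i.e. symmetric, nonnegative) quadratic form with domain $\mathcal D\subseteq\mathcal H$; write $\mathcal E(\cdot,\cdot)$ for the associated sesquilinear form, $\mathcal E[u]:=\mathcal E(u,u)$, and $\mathcal E_\lambda[u]:=\mathcal E[u]+\lambda\|u\|^2$ for $\lambda>0$. Let $J\colon\operatorname{dom}J\subseteq\mathcal D\to\mathcal H_{\mathrm{aux}}$ be a linear operator with dense range which is closed as an operator from $(\mathcal D,\mathcal E_1^{1/2})$ to $\mathcal H_{\mathrm{aux}}$. For $\lambda>0$ let $P_\lambda$ be the $\mathcal E_\lambda$-orthogonal projection in the Hilbert space $(\mathcal D,\mathcal E_\lambda^{1/2})$ onto the $\mathcal E_\lambda$-orthogonal complement of $\ker J$. Define the closed positive densely defined quadratic form $\check{\mathcal E}_\lambda$ in $\mathcal H_{\mathrm{aux}}$ by $\operatorname{dom}\check{\mathcal E}_\lambda:=\operatorname{ran}J$, $\check{\mathcal E}_\lambda[Ju]:=\mathcal E_\lambda[P_\lambda u]$ for $u\in\operatorname{dom}J$, and let $\check H_\lambda$ be the associated positive self-adjoint operator. Trace form: let $\check{\mathcal E}_0$ be the form with $\operatorname{dom}\check{\mathcal E}_0=\operatorname{ran}J$, $\check{\mathcal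 E}_0[Ju]=\lim_{\lambda\downarrow0}\check{\mathcal E}_\lambda[Ju]$. The trace $\check{\mathcal E}$ of $\mathcal E$ with respect to $J$ is the closed form associated with the positive self-adjoint operator $\check H$ determined by $(\check H_\lambda+1)^{-1}\to(\check H+1)^{-1}$ strongly as $\lambda\downarrow0$; equivalently, $\check{\mathcal E}=\overline{(\check{\mathcal E}_0)_{\mathrm{reg}}}$. Here, for a densely defined positive quadratic form $Q$, the regular part $Q_{\mathrm{reg}}$ is the largest positive densely defined closable quadratic form (with the same domain) dominated by $Q$. Set $\mathcal H^J_{\mathrm{har}}:=\{u\in\operatorname{dom}J:\ \mathcal E(u,v)=0\text{ for all }v\in\ker J\}$. When $\operatorname{dom}J=\mathcal H^J_{\mathrm{har}}\oplus\ker J$, let $E_{\mathrm{har}}$ be the projection from $\operatorname{dom}J$ onto $\mathcal H^J_{\mathrm{har}}$ along $\ker J$, and define the form $\mathcal E_{\mathrm{har}}$ in $\mathcal H_{\mathrm{aux}}$ by $\operatorname{dom}\mathcal E_{\mathrm{har}}:=\operatorname{ran}J$, $\mathcal E_{\mathrm{har}}[Ju]:=\mathcal E[E_{\mathrm{har}}u]$ for $u\in\operatorname{dom}J$ (well defined). *)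

theory Defs
  imports "HOL-Analysis.Analysis"
begin

section \<open>Complex Hilbert spaces\<close>

text \<open>
  A complex Hilbert space is a Banach space whose norm comes from an inner product
  that is linear in the first and conjugate-linear in the second argument.
\<close>

class complex_hilbert = banach +
  fixes scaleC :: "complex \<Rightarrow> 'a \<Rightarrow> 'a" (infixr "*\<^sub>C" 75)
    and cinner :: "'a \<Rightarrow> 'a \<Rightarrow> complex"
  assumes scaleC_add_right: "c *\<^sub>C (x + y) = c *\<^sub>C x + c *\<^sub>C y"
    and scaleC_add_left: "(c + d) *\<^sub>C x = c *\<^sub>C x + d *\<^sub>C x"
    and scaleC_scaleC: "c *\<^sub>C d *\<^sub>C x = (c * d) *\<^sub>C x"
    and scaleR_eq_scaleC: "r *\<^sub>R x = complex_of_real r *\<^sub>C x"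
    and cinner_commute: "cinner x y = cnj (cinner y x)"
    and cinner_add_left: "cinner (x + y) z = cinner x z + cinner y z"
    and cinner_scaleC_left: "cinner (c *\<^sub>C x) y = c * cinner x y"
    and cinner_self: "cinner x x = complex_of_real ((norm x)\<^sup>2)"

global_interpretation complex_vector:
  vector_space "scaleC :: complex \<Rightarrow> 'a \<Rightarrow> 'a::complex_hilbert"
proof
  fix c d :: complex and x y :: 'a
  show "c *\<^sub>C (x + y) = c *\<^sub>C x + c *\<^sub>C y" by (rule scaleC_add_right)
  show "(c + d) *\<^sub>C x = c *\<^sub>C x + d *\<^sub>C x" by (rule scaleC_add_left)
  show "c *\<^sub>C d *\<^sub>C x = (c * d) *\<^sub>C x" by (rule scaleC_scaleC)
  show "1 *\<^sub>C x = x" using scaleR_eq_scaleC[of 1 x] by simp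
qed

instantiation complex :: complex_hilbert
begin

definition scaleC_complex :: "complex \<Rightarrow> complex \<Rightarrow> complex"
  where "scaleC_complex c x = c * x"

definition cinner_complex :: "complex \<Rightarrow> complex \<Rightarrow> complex"
  where "cinner_complex x y = x * cnj y"

instance
  by standard
    (simp_all add: scaleC_complex_def cinner_complex_def scaleR_conv_of_real
      algebra_simps complex_norm_square del: of_real_power)

end


section \<open>Unbounded operators\<close>

text \<open>
  Unbounded operators and quadratic forms are partial functions, so that their domain is part
  of the object and equality of operators or forms includes equality of domains.
\<close>

type_synonym ('a, 'b) operator = "'a \<rightharpoonup> 'b"

definition linear_operator ::
  "('a::complex_hilbert, 'b::complex_hilbert) operator \<Rightarrow> bool"
  where "linear_operator A \<longleftrightarrow>
    complex_vector.subspace (dom A) \<and>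
    (\<forall>u\<in>dom A. \<forall>v\<in>dom A. A (u + v) = Some (the (A u) + the (A v))) \<and>
    (\<forall>c. \<forall>u\<in>dom A. A (c *\<^sub>C u) = Some (c *\<^sub>C the (A u)))"

definition kernel :: "('a, 'b::zero) operator \<Rightarrow> 'a set"
  where "kernel A = {u. A u = Some 0}"

definition op_adjoint ::
  "('a::complex_hilbert, 'b::complex_hilbert) operator \<Rightarrow> ('b, 'a) operator"
  where "op_adjoint A v =
    (if \<exists>w. \<forall>u\<in>dom A. cinner (the (A u)) v = cinner u w
     then Some (THE w. \<forall>u\<in>dom A. cinner (the (A u)) v = cinner u w)
     else None)"

definition positive_selfadjoint :: "('a::complex_hilbert, 'a) operator \<Rightarrow> bool"
  where "positive_selfadjoint H \<longleftrightarrow>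
    linear_operator H \<and> closure (dom H) = UNIV \<and> op_adjoint H = H \<and>
    (\<forall>u\<in>dom H. 0 \<le> Re (cinner (the (H u)) u))"

text \<open>The bounded operator \<open>(H + 1)\<^sup>-\<^sup>1\<close>, for positive self-adjoint \<open>H\<close>.\<close>

definition resolvent1 :: "('a::complex_hilbert, 'a) operator \<Rightarrow> 'a \<Rightarrow> 'a"
  where "resolvent1 H g = (THE u. u \<in> dom H \<and> the (H u) + u = g)"


section \<open>Positive quadratic forms\<close>

type_synonym 'a form = "'a \<rightharpoonup> real"

definition sesquilinear_on ::
  "'a::complex_hilbert set \<Rightarrow> ('a \<Rightarrow> 'a \<Rightarrow> complex) \<Rightarrow> bool"
  where "sesquilinear_on D s \<longleftrightarrow>
    (\<forall>u\<in>D. \<forall>v\<in>D. \<forall>w\<in>D. s (u + v) w = s u w + s v w \<and> s w (u + v) = s w u + s w v) \<and>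
    (\<forall>c. \<forall>u\<in>D. \<forall>v\<in>D. s (c *\<^sub>C u) v = c * s u v \<and> s u (c *\<^sub>C v) = cnj c * s u v)"

definition positive_form :: "'a::complex_hilbert form \<Rightarrow> bool"
  where "positive_form Q \<longleftrightarrow>
    complex_vector.subspace (dom Q) \<and>
    (\<forall>u\<in>dom Q. 0 \<le> the (Q u)) \<and>
    (\<exists>s. sesquilinear_on (dom Q) s \<and> (\<forall>u\<in>dom Q. s u u = complex_of_real (the (Q u))))"

text \<open>The associated sesquilinear form, recovered by polarization.\<close>

definition sesq :: "'a::complex_hilbert form \<Rightarrow> 'a \<Rightarrow> 'a \<Rightarrow> complex"
  where "sesq Q u v =
    (\<Sum>k<4. \<i> ^ k * complex_of_real (the (Q (u + \<i> ^ k *\<^sub>C v)))) / 4"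

lemma sesq_eq:
  assumes D: "complex_vector.subspace (dom Q)" and s: "sesquilinear_on (dom Q) s"
    and diag: "\<And>u. u \<in> dom Q \<Longrightarrow> s u u = complex_of_real (the (Q u))"
    and u: "u \<in> dom Q" and v: "v \<in> dom Q"
  shows "sesq Q u v = s u v"
proof -
  have expand: "complex_of_real (the (Q (u + c *\<^sub>C v))) =
      s u u + cnj c * s u v + c * s v u + c * cnj c * s v v" for c
  proof -
    have cv: "c *\<^sub>C v \<in> dom Q"
      by (rule complex_vector.subspace_scale[OF D v])
    have ucv: "u + c *\<^sub>C v \<in> dom Q"
      by (rule complex_vector.subspace_add[OF D u cv])
    have "complex_of_real (the (Q (u + c *\<^sub>C v))) = s (u + c *\<^sub>C v) (u + c *\<^sub>C v)"
      using diag[OF ucv] by simp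
    also have "\<dots> = s u (u + c *\<^sub>C v) + s (c *\<^sub>C v) (u + c *\<^sub>C v)"
      using s u cv ucv unfolding sesquilinear_on_def by blast
    also have "s u (u + c *\<^sub>C v) = s u u + s u (c *\<^sub>C v)"
      using s u cv unfolding sesquilinear_on_def by blast
    also have "s (c *\<^sub>C v) (u + c *\<^sub>C v) = s (c *\<^sub>C v) u + s (c *\<^sub>C v) (c *\<^sub>C v)"
      using s u cv unfolding sesquilinear_on_def by blast
    also have "s u (c *\<^sub>C v) = cnj c * s u v"
      using s u v unfolding sesquilinear_on_def by blast
    also have "s (c *\<^sub>C v) u = c * s v u"
      using s u v unfolding sesquilinear_on_def by blast
    also have "s (c *\<^sub>C v) (c *\<^sub>C v) = c * s v (c *\<^sub>C v)"
      using s v cv unfolding sesquilinear_on_def by blast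
    also have "s v (c *\<^sub>C v) = cnj c * s v v"
      using s v unfolding sesquilinear_on_def by blast
    finally show ?thesis by (simp add: algebra_simps)
  qed
  show ?thesis
    unfolding sesq_def expand
    by (simp add: eval_nat_numeral algebra_simps)
qed

definition closed_form :: "'a::complex_hilbert form \<Rightarrow> bool"
  where "closed_form Q \<longleftrightarrow>
    positive_form Q \<and>
    (\<forall>x u. (\<forall>n. x n \<in> dom Q) \<and> x \<longlonglongrightarrow> u \<and>
       (\<forall>e>0. \<exists>N. \<forall>m\<ge>N. \<forall>n\<ge>N. the (Q (x m - x n)) < e) \<longrightarrow>
       u \<in> dom Q \<and> (\<lambda>n. the (Q (x n - u))) \<longlonglongrightarrow> 0)"

definition densely_defined :: "'a::complex_hilbert form \<Rightarrow> bool"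
  where "densely_defined Q \<longleftrightarrow> closure (dom Q) = UNIV"

definition closable_form :: "'a::complex_hilbert form \<Rightarrow> bool"
  where "closable_form Q \<longleftrightarrow> positive_form Q \<and> (\<exists>R. closed_form R \<and> Q \<subseteq>\<^sub>m R)"

definition form_closure :: "'a::complex_hilbert form \<Rightarrow> 'a form"
  where "form_closure Q =
    (THE R. closed_form R \<and> Q \<subseteq>\<^sub>m R \<and> (\<forall>S. closed_form S \<and> Q \<subseteq>\<^sub>m S \<longrightarrow> R \<subseteq>\<^sub>m S))"

text \<open>\<open>minorant Q R\<close>: \<open>R\<close> is one of the forms of which the regular part of \<open>Q\<close> is the largest.\<close>

definition minorant :: "'a::complex_hilbert form \<Rightarrow> 'a form \<Rightarrow> bool"
  where "minorant Q R \<longleftrightarrow>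
    closable_form R \<and> densely_defined R \<and> dom R = dom Q \<and>
    (\<forall>u\<in>dom Q. the (R u) \<le> the (Q u))"

definition regular_part :: "'a::complex_hilbert form \<Rightarrow> 'a form"
  where "regular_part Q =
    (THE R. minorant Q R \<and>
       (\<forall>S. minorant Q S \<longrightarrow> (\<forall>u\<in>dom Q. the (S u) \<le> the (R u))))"

text \<open>
  The operator associated with a form: \<open>H u = f\<close> iff \<open>u \<in> dom Q\<close> and
  \<open>Q(u,v) = \<langle>f,v\<rangle>\<close> for all \<open>v \<in> dom Q\<close>.
\<close>

definition form_operator :: "'a::complex_hilbert form \<Rightarrow> ('a, 'a) operator"
  where "form_operator Q u =
    (if u \<in> dom Q \<and> (\<exists>f. \<forall>v\<in>dom Q. sesq Q u v = cinner f v)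
     then Some (THE f. \<forall>v\<in>dom Q. sesq Q u v = cinner f v)
     else None)"

text \<open>The form \<open>u \<mapsto> E[u] + \<lambda> \<parallel>u\<parallel>\<^sup>2\<close>, with the same domain as \<open>E\<close>.\<close>

definition shift_form :: "'a::complex_hilbert form \<Rightarrow> real \<Rightarrow> 'a form"
  where "shift_form E l u = map_option (\<lambda>r. r + l * (norm u)\<^sup>2) (E u)"


section \<open>The trace of a form\<close>

text \<open>Closedness of \<open>J\<close> as an operator from \<open>dom E\<close> with the norm \<open>E\<^sub>1[\<cdot>]\<^sup>1\<^sup>/\<^sup>2\<close>.\<close>

definition form_closed_operator ::
  "'a::complex_hilbert form \<Rightarrow> ('a, 'b::complex_hilbert) operator \<Rightarrow> bool"
  where "form_closed_operator E J \<longleftrightarrow>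
    (\<forall>x u f. (\<forall>n. x n \<in> dom J) \<and> u \<in> dom E \<and>
       (\<lambda>n. the (shift_form E 1 (x n - u))) \<longlonglongrightarrow> 0 \<and> (\<lambda>n. the (J (x n))) \<longlonglongrightarrow> f \<longrightarrow>
       J u = Some f)"

definition orth_complement :: "'a::complex_hilbert form \<Rightarrow> 'a set \<Rightarrow> 'a set"
  where "orth_complement Q K = {v \<in> dom Q. \<forall>k\<in>K. sesq Q v k = 0}"

definition orth_projection :: "'a::complex_hilbert form \<Rightarrow> 'a set \<Rightarrow> 'a \<Rightarrow> 'a"
  where "orth_projection Q M u = (THE w. w \<in> M \<and> (\<forall>m\<in>M. sesq Q (u - w) m = 0))"

definition trace_proj ::
  "'a::complex_hilbert form \<Rightarrow> ('a, 'b::complex_hilbert) operator \<Rightarrow> real \<Rightarrow> 'a \<Rightarrow> 'a"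
  where "trace_proj E J l =
    orth_projection (shift_form E l) (orth_complement (shift_form E l) (kernel J))"

definition approx_trace ::
  "'a::complex_hilbert form \<Rightarrow> ('a, 'b::complex_hilbert) operator \<Rightarrow> real \<Rightarrow> 'b form"
  where "approx_trace E J l f =
    (if f \<in> ran J
     then Some (THE r. \<exists>u. J u = Some f \<and> r = the (shift_form E l (trace_proj E J l u)))
     else None)"

definition trace_operator ::
  "'a::complex_hilbert form \<Rightarrow> ('a, 'b::complex_hilbert) operator \<Rightarrow> ('b, 'b) operator"
  where "trace_operator E J =
    (THE H. positive_selfadjoint H \<and>
       (\<forall>g. ((\<lambda>l. resolvent1 (form_operator (approx_trace E J l)) g) \<longlongrightarrow> resolvent1 H g)
              (at_right 0)))"

definition trace_form ::
  "'a::complex_hilbert form \<Rightarrow> ('a, 'b::complex_hilbert) operator \<Rightarrow> 'b form"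
  where "trace_form E J =
    (THE T. closed_form T \<and> densely_defined T \<and> form_operator T = trace_operator E J)"


section \<open>Harmonic elements\<close>

definition harmonic_space ::
  "'a::complex_hilbert form \<Rightarrow> ('a, 'b::complex_hilbert) operator \<Rightarrow> 'a set"
  where "harmonic_space E J = {u \<in> dom J. \<forall>v\<in>kernel J. sesq E u v = 0}"

definition harmonic_proj ::
  "'a::complex_hilbert form \<Rightarrow> ('a, 'b::complex_hilbert) operator \<Rightarrow> 'a \<Rightarrow> 'a"
  where "harmonic_proj E J u = (THE h. h \<in> harmonic_space E J \<and> u - h \<in> kernel J)"

definition harmonic_form ::
  "'a::complex_hilbert form \<Rightarrow> ('a, 'b::complex_hilbert) operator \<Rightarrow> 'b form"
  where "harmonic_form E J f =
    (if f \<in> ran J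
     then Some (THE r. \<exists>u. J u = Some f \<and> r = the (E (harmonic_proj E J u)))
     else None)"

end

theory Submission
  imports Defs
begin

text \<open>
  For \<open>\<lambda> > 0\<close> and \<open>f \<in> ran J\<close>, the value of the approximating trace at \<open>f\<close> is the minimum of
  \<open>E[u] + \<lambda>\<parallel>u\<parallel>\<^sup>2\<close> over the fibre \<open>J u = f\<close>. If \<open>h\<close> is the harmonic element of that fibre, it
  minimises \<open>E[u]\<close> there, so the value lies between \<open>E[h]\<close> and \<open>E[h] + \<lambda>\<parallel>h\<parallel>\<^sup>2\<close>. The
  approximating traces are therefore closed forms on the common dense domain \<open>ran J\<close> which tend to
  the harmonic form \<open>Q\<close> pointwise and from above (\<open>harmonic_form_bounds\<close>). What remains is a
  theorem about every such limit: the resolvents converge strongly to the resolvent of the closure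
  of the regular part of \<open>Q\<close>.

  The limit form is written down explicitly. The Moreau envelope
  \<open>M\<^sub>n[f] = inf\<^sub>v (Q[v] + n\<parallel>v - f\<parallel>\<^sup>2)\<close> is bounded by \<open>n\<parallel>f\<parallel>\<^sup>2\<close>, and it is a quadratic form: for a closed
  form the infimum is attained at a point that depends linearly on \<open>f\<close>, and \<open>M\<^sub>n\<close> is the limit of
  the envelopes of the approximating closed forms. It increases with \<open>n\<close>, and \<open>T = sup\<^sub>n M\<^sub>n\<close>, with
  the \<open>f\<close> of finite supremum as domain, is a closed form below \<open>Q\<close>, because it is a supremum of
  continuous quadratic forms.

  It is the closure of the regular part. A closed form is the supremum of its own envelopes
  (\<open>closed_form_bounded_envelope\<close>), and envelopes are monotone in the form; so the restriction of
  \<open>T\<close> to \<open>dom Q\<close> lies above every closable minorant of \<open>Q\<close>, which makes it the regular part.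
  Approximate minimisers of the envelopes give, for each \<open>f \<in> dom T\<close>, a sequence in \<open>dom Q\<close> that
  converges to \<open>f\<close> in the form norm of \<open>T\<close>; so \<open>dom Q\<close> is a core of \<open>T\<close>.

  The resolvents converge because \<open>(H + 1)\<^sup>-\<^sup>1 g\<close> is the minimiser of \<open>v \<mapsto> S[v] + \<parallel>v - g\<parallel>\<^sup>2\<close> for the
  form \<open>S\<close> of \<open>H\<close>. The minimum for the approximating form tends to \<open>M\<^sub>1[g]\<close>, which is also the
  minimum for \<open>T\<close>; since \<open>T\<close> lies below the approximating forms, the approximating minimisers form
  a minimising family for \<open>T\<close>, and the excess over the minimum controls the squared distance from
  the minimiser.

  Finally, a closed densely defined form gives a positive self-adjoint operator, such an operator is
  determined by its resolvent, and the form is determined by its operator. Hence the limit operator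
  and its form are unique, and the trace form is \<open>T\<close>.
\<close>

section \<open>Sesquilinear forms on a subspace\<close>

text \<open>
  The discriminant inequality behind Cauchy-Schwarz. The case \<open>A = 0\<close>, which forces \<open>z = 0\<close>, is the
  first-order condition at a minimum.
\<close>

lemma complex_square_le_of_quadratic_nonneg:
  fixes z :: complex and A B :: real
  assumes nonneg: "\<And>c. 0 \<le> A + 2 * Re (cnj c * z) + (cmod c)\<^sup>2 * B" and B: "0 \<le> B"
  shows "(cmod z)\<^sup>2 \<le> A * B"
proof (cases "B = 0")
  case True
  have "(cmod z)\<^sup>2 = 0"
  proof (rule ccontr)
    assume ne: "(cmod z)\<^sup>2 \<noteq> 0"
    \<comment> \<open>The choice \<open>c = -t z\<close> turns the hypothesis into \<open>0 \<le> A - 2 t |z|\<^sup>2\<close>, and this \<open>t\<close> makes the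
      right-hand side equal to \<open>-1\<close>.\<close>
    define t where "t = (A + 1) / (2 * (cmod z)\<^sup>2)"
    have "cnj (- of_real t * z) * z = - of_real (t * (cmod z)\<^sup>2)"
      by (simp add: complex_norm_square mult.commute del: of_real_power)
    then have "0 \<le> A - 2 * (t * (cmod z)\<^sup>2)"
      using nonneg[of "- of_real t * z"] True by (simp del: of_real_mult of_real_power)
    then show False using ne by (simp add: t_def)
  qed
  then show ?thesis using True by simp
next
  case False
  then have pos: "0 < B" using B by simp
  have "cnj (- z / of_real B) * z = - of_real ((cmod z)\<^sup>2 / B)"
    by (simp add: complex_norm_square mult.commute del: of_real_power)
  then have "0 \<le> A - 2 * ((cmod z)\<^sup>2 / B) + (cmod z / B)\<^sup>2 * B"
    using nonneg[of "- z / of_real B"] pos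
    by (simp add: norm_divide del: of_real_divide of_real_power)
  then show ?thesis using pos by (simp add: field_simps power2_eq_square)
qed

lemma tendsto_zero_if_norm_le:
  assumes "\<And>n. norm (f n :: 'a::real_normed_vector) \<le> g n" and "g \<longlonglongrightarrow> 0"
  shows "f \<longlonglongrightarrow> 0"
  by (rule Lim_null_comparison[of _ g]) (use assms in auto)

lemma tendsto_if_norm_square_tendsto_zero:
  fixes x :: "nat \<Rightarrow> 'a::real_normed_vector"
  assumes "(\<lambda>n. (norm (x n - u))\<^sup>2) \<longlonglongrightarrow> 0"
  shows "x \<longlonglongrightarrow> u"
proof -
  have "(\<lambda>n. sqrt ((norm (x n - u))\<^sup>2)) \<longlonglongrightarrow> sqrt 0"
    by (rule tendsto_real_sqrt[OF assms])
  then show ?thesis by (simp add: tendsto_norm_zero_iff LIM_zero_iff)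
qed

text \<open>
  Defined outside the locale below, so that it can be used for several sesquilinear forms at once.
\<close>

definition quadratic :: "('a \<Rightarrow> 'a \<Rightarrow> complex) \<Rightarrow> 'a \<Rightarrow> real"
  where "quadratic s u = Re (s u u)"

text \<open>
  Positive semidefinite sesquilinear forms on a subspace. The forms \<open>sesq Q\<close>, \<open>sesq Q + l \<cdot> cinner\<close>
  and \<open>cinner\<close> itself are all handled as instances.
\<close>

locale semi_inner =
  fixes D :: "'a::complex_hilbert set" and s :: "'a \<Rightarrow> 'a \<Rightarrow> complex"
  assumes subspace: "complex_vector.subspace D"
    and sesquilinear: "sesquilinear_on D s"
    and diag_real: "u \<in> D \<Longrightarrow> Im (s u u) = 0"
    and diag_nonneg: "u \<in> D \<Longrightarrow> 0 \<le> Re (s u u)"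
begin

abbreviation nsq :: "'a \<Rightarrow> real" where "nsq \<equiv> quadratic s"

lemma zero_mem: "0 \<in> D"
  using complex_vector.subspace_0[OF subspace] .

lemma add_mem: "u \<in> D \<Longrightarrow> v \<in> D \<Longrightarrow> u + v \<in> D"
  using complex_vector.subspace_add[OF subspace] .

lemma diff_mem: "u \<in> D \<Longrightarrow> v \<in> D \<Longrightarrow> u - v \<in> D"
  using complex_vector.subspace_diff[OF subspace] .

lemma scale_mem: "u \<in> D \<Longrightarrow> c *\<^sub>C u \<in> D"
  using complex_vector.subspace_scale[OF subspace] .

lemmas mem = zero_mem add_mem diff_mem scale_mem

lemma add_left: "u \<in> D \<Longrightarrow> v \<in> D \<Longrightarrow> w \<in> D \<Longrightarrow> s (u + v) w = s u w + s v w"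
  and add_right: "u \<in> D \<Longrightarrow> v \<in> D \<Longrightarrow> w \<in> D \<Longrightarrow> s w (u + v) = s w u + s w v"
  and scale_left: "u \<in> D \<Longrightarrow> w \<in> D \<Longrightarrow> s (c *\<^sub>C u) w = c * s u w"
  and scale_right: "u \<in> D \<Longrightarrow> w \<in> D \<Longrightarrow> s w (c *\<^sub>C u) = cnj c * s w u"
  using sesquilinear unfolding sesquilinear_on_def by blast+

lemma diff_left: "u \<in> D \<Longrightarrow> v \<in> D \<Longrightarrow> w \<in> D \<Longrightarrow> s (u - v) w = s u w - s v w"
  using add_left[of u "(-1) *\<^sub>C v" w] scale_left[of v w "-1"] scale_mem[of v "-1"] by simp

lemma diff_right: "u \<in> D \<Longrightarrow> v \<in> D \<Longrightarrow> w \<in> D \<Longrightarrow> s w (u - v) = s w u - s w v"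
  using add_right[of u "(-1) *\<^sub>C v" w] scale_right[of v w "-1"] scale_mem[of v "-1"] by simp

lemmas expand = add_left add_right scale_left scale_right diff_left diff_right mem

lemma nsq_nonneg: "u \<in> D \<Longrightarrow> 0 \<le> nsq u"
  by (simp add: quadratic_def diag_nonneg)

lemma diag: "u \<in> D \<Longrightarrow> s u u = of_real (nsq u)"
  by (simp add: quadratic_def complex_eq_iff diag_real)

text \<open>
  Polarization: the diagonal is real at \<open>u + v\<close> and at \<open>u + \<i> v\<close>.
\<close>

lemma hermitian:
  assumes "u \<in> D" "v \<in> D"
  shows "s v u = cnj (s u v)"
proof -
  have "Im (s (u + v) (u + v)) = 0" "Im (s (u + \<i> *\<^sub>C v) (u + \<i> *\<^sub>C v)) = 0"
    using assms by (simp_all add: diag_real mem)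
  then show ?thesis
    using assms diag_real[of u] diag_real[of v] by (simp add: expand complex_eq_iff)
qed

lemma nsq_add_scaled:
  assumes "u \<in> D" "v \<in> D"
  shows "nsq (u + c *\<^sub>C v) = nsq u + 2 * Re (cnj c * s u v) + (cmod c)\<^sup>2 * nsq v"
proof -
  have c: "(cmod c)\<^sup>2 = (Re c)\<^sup>2 + (Im c)\<^sup>2"
    by (simp add: cmod_power2)
  show ?thesis
    using assms hermitian[of u v] diag_real[of v] c
    by (simp add: quadratic_def expand algebra_simps power2_eq_square)
qed

lemma nsq_add: "u \<in> D \<Longrightarrow> v \<in> D \<Longrightarrow> nsq (u + v) = nsq u + 2 * Re (s u v) + nsq v"
  using nsq_add_scaled[of u v 1] by simp

lemma nsq_diff: "u \<in> D \<Longrightarrow> v \<in> D \<Longrightarrow> nsq (u - v) = nsq u - 2 * Re (s u v) + nsq v"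
  using nsq_add_scaled[of u v "-1"] by simp

lemma nsq_scale: "u \<in> D \<Longrightarrow> nsq (c *\<^sub>C u) = (cmod c)\<^sup>2 * nsq u"
  using nsq_add_scaled[of 0 u c] zero_mem scale_left[of 0 0 0] scale_left[of 0 u 0]
  by (simp add: quadratic_def)

lemma nsq_zero: "nsq 0 = 0"
  using nsq_scale[of 0 0] zero_mem by simp

lemma parallelogram:
  "u \<in> D \<Longrightarrow> v \<in> D \<Longrightarrow> nsq (u + v) + nsq (u - v) = 2 * nsq u + 2 * nsq v"
  by (simp add: nsq_add nsq_diff)

lemma nsq_commute: "u \<in> D \<Longrightarrow> v \<in> D \<Longrightarrow> nsq (u - v) = nsq (v - u)"
  using nsq_scale[of "u - v" "-1"] diff_mem[of u v] by simp

lemma Cauchy_Schwarz: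
  assumes "u \<in> D" "v \<in> D"
  shows "(cmod (s u v))\<^sup>2 \<le> nsq u * nsq v"
proof (rule complex_square_le_of_quadratic_nonneg)
  show "0 \<le> nsq u + 2 * Re (cnj c * s u v) + (cmod c)\<^sup>2 * nsq v" for c
    using nsq_nonneg[of "u + c *\<^sub>C v"] nsq_add_scaled[OF assms] assms by (simp add: mem)
qed (simp add: assms nsq_nonneg)

lemma triangle:
  assumes "u \<in> D" "v \<in> D"
  shows "sqrt (nsq (u + v)) \<le> sqrt (nsq u) + sqrt (nsq v)"
proof (rule real_le_lsqrt)
  have "Re (s u v) \<le> sqrt (nsq u * nsq v)"
    using complex_Re_le_cmod real_le_rsqrt[OF Cauchy_Schwarz[OF assms]] by (rule order_trans)
  then show "nsq (u + v) \<le> (sqrt (nsq u) + sqrt (nsq v))\<^sup>2"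
    using assms by (simp add: nsq_add power2_sum nsq_nonneg real_sqrt_mult)
qed (simp add: nsq_nonneg assms)

lemma nsq_tendsto:
  assumes "\<And>n. x n \<in> D" "u \<in> D" and lim: "(\<lambda>n. nsq (x n - u)) \<longlonglongrightarrow> 0"
  shows "(\<lambda>n. nsq (x n)) \<longlonglongrightarrow> nsq u"
proof -
  have "norm (sqrt (nsq (x n)) - sqrt (nsq u)) \<le> sqrt (nsq (x n - u))" for n
    using triangle[of "x n - u" u] triangle[of "u - x n" "x n"] nsq_commute[of "x n" u] assms
    by (simp add: mem)
  moreover have "(\<lambda>n. sqrt (nsq (x n - u))) \<longlonglongrightarrow> 0"
    using tendsto_real_sqrt[OF lim] unfolding real_sqrt_zero .
  ultimately have "(\<lambda>n. sqrt (nsq (x n)) - sqrt (nsq u)) \<longlonglongrightarrow> 0"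
    by (rule tendsto_zero_if_norm_le)
  then have "(\<lambda>n. sqrt (nsq (x n))) \<longlonglongrightarrow> sqrt (nsq u)"
    by (rule Lim_null[THEN iffD2])
  from tendsto_power[OF this, of 2] show ?thesis
    by (simp add: nsq_nonneg assms)
qed

lemma s_tendsto:
  assumes "\<And>n. x n \<in> D" "u \<in> D" "k \<in> D" and lim: "(\<lambda>n. nsq (x n - u)) \<longlonglongrightarrow> 0"
  shows "(\<lambda>n. s (x n) k) \<longlonglongrightarrow> s u k"
proof -
  have "cmod (s (x n) k - s u k) \<le> sqrt (nsq (x n - u) * nsq k)" for n
    using real_le_rsqrt[OF Cauchy_Schwarz[of "x n - u" k]] assms by (simp add: mem diff_left)
  moreover have "(\<lambda>n. sqrt (nsq (x n - u) * nsq k)) \<longlonglongrightarrow> 0"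
    using tendsto_real_sqrt[OF tendsto_mult_left_zero[OF lim, of "nsq k"]] unfolding real_sqrt_zero .
  ultimately have "(\<lambda>n. s (x n) k - s u k) \<longlonglongrightarrow> 0"
    by (rule tendsto_zero_if_norm_le)
  then show ?thesis by (rule Lim_null[THEN iffD2])
qed

lemma Cauchy_nsq:
  assumes "\<And>n. x n \<in> D" "u \<in> D" and lim: "(\<lambda>n. nsq (x n - u)) \<longlonglongrightarrow> 0" and e: "0 < e"
  shows "\<exists>N. \<forall>m\<ge>N. \<forall>n\<ge>N. nsq (x m - x n) < e"
proof -
  have "\<forall>\<^sub>F n in sequentially. nsq (x n - u) < e / 4"
    using order_tendstoD(2)[OF lim, of "e / 4"] e by simp
  then obtain N where N: "\<And>n. n \<ge> N \<Longrightarrow> nsq (x n - u) < e / 4"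
    by (auto simp: eventually_sequentially)
  have "nsq (x m - x n) < e" if "m \<ge> N" "n \<ge> N" for m n
  proof -
    have "nsq ((x m - u) - (x n - u)) \<le> 2 * nsq (x m - u) + 2 * nsq (x n - u)"
      using parallelogram[of "x m - u" "x n - u"] nsq_nonneg[of "(x m - u) + (x n - u)"] assms
      by (simp add: mem)
    then show ?thesis using N[OF that(1)] N[OF that(2)] by simp
  qed
  then show ?thesis by blast
qed

end

locale complete_inner = semi_inner +
  assumes complete: "\<lbrakk>\<And>n. x n \<in> D; \<And>e. 0 < e \<Longrightarrow> \<exists>N. \<forall>m\<ge>N. \<forall>n\<ge>N. nsq (x m - x n) < e\<rbrakk>
    \<Longrightarrow> \<exists>u\<in>D. (\<lambda>n. nsq (x n - u)) \<longlonglongrightarrow> 0"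
begin


text \<open>
  The Riesz representation theorem on the closure of \<open>K\<close>, by minimising \<open>[v] - 2 Re l(v)\<close> over \<open>K\<close>:
  the parallelogram law makes a minimising sequence Cauchy, and its limit \<open>p\<close> satisfies the
  first-order condition. Keeping the sequence in the conclusion lets the same statement serve for
  \<open>K = D\<close> (existence of resolvents), for \<open>K\<close> a closed subspace (orthogonal projections), and for
  \<open>K\<close> the domain of an operator (proof that it is a core).
\<close>

lemma Riesz_on_subspace:
  fixes l :: "'a \<Rightarrow> complex"
  assumes K: "complex_vector.subspace K" "K \<subseteq> D"
    and l_add: "\<And>u v. u \<in> K \<Longrightarrow> v \<in> K \<Longrightarrow> l (u + v) = l u + l v"
    and l_scale: "\<And>c u. u \<in> K \<Longrightarrow> l (c *\<^sub>C u) = cnj c * l u"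
    and C: "0 \<le> C" and l_bound: "\<And>u. u \<in> K \<Longrightarrow> (cmod (l u))\<^sup>2 \<le> C * nsq u"
  shows "\<exists>p\<in>D. (\<exists>x. (\<forall>n. x n \<in> K) \<and> (\<lambda>n. nsq (x n - p)) \<longlonglongrightarrow> 0) \<and> (\<forall>k\<in>K. s p k = l k)"
proof -
  define F where "F v = nsq v - 2 * Re (l v)" for v
  define m where "m = Inf (F ` K)"
  have KD: "v \<in> D" if "v \<in> K" for v using that K by auto
  have K0: "0 \<in> K" by (rule complex_vector.subspace_0[OF K(1)])
  have Kadd: "u + c *\<^sub>C v \<in> K" if "u \<in> K" "v \<in> K" for u v c
    using that K(1) by (simp add: complex_vector.subspace_add complex_vector.subspace_scale)
  have "- C \<le> F v" if v: "v \<in> K" for v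
  proof -
    have "Re (l v) \<le> sqrt (C * nsq v)"
      using complex_Re_le_cmod real_le_rsqrt[OF l_bound[OF v]] by (rule order_trans)
    also have "\<dots> \<le> (C + nsq v) / 2"
      using C nsq_nonneg[OF KD[OF v]] by (rule arith_geo_mean_sqrt)
    finally show ?thesis by (simp add: F_def)
  qed
  then have bdd: "bdd_below (F ` K)" by (intro bdd_belowI2)
  have m_le: "m \<le> F v" if "v \<in> K" for v
    unfolding m_def using bdd that by (rule cINF_lower)
  define eps where "eps n = inverse (real (Suc n))" for n
  have eps_pos: "0 < eps n" for n by (simp add: eps_def)
  have "\<exists>v\<in>K. F v < m + eps n" for n
    using cInf_lessD[of "F ` K" "m + eps n"] K0 eps_pos[of n] unfolding m_def by auto
  then obtain x where xK: "\<And>n. x n \<in> K" and x: "\<And>n. F (x n) < m + eps n"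
    by metis
  have xD: "x n \<in> D" for n using xK KD by blast
  have F_step: "F (u + c *\<^sub>C k) = F u + 2 * Re (cnj c * (s u k - l k)) + (cmod c)\<^sup>2 * nsq k"
    if "u \<in> K" "k \<in> K" for u k c
  proof -
    have "l (u + c *\<^sub>C k) = l u + cnj c * l k"
      using that K(1) by (simp add: l_add l_scale complex_vector.subspace_scale)
    then show ?thesis
      using that by (simp add: F_def nsq_add_scaled KD algebra_simps)
  qed
  have close: "nsq (x i - x j) \<le> 2 * (eps i + eps j)" for i j
  proof -
    \<comment> \<open>The midpoint of \<open>x i\<close> and \<open>x j\<close> lies in \<open>K\<close>, so that its value is at least \<open>m\<close>.\<close>
    define d where "d = x j - x i"
    have d: "d \<in> K" "d \<in> D" unfolding d_def
      using xK xD by (auto simp: diff_mem complex_vector.subspace_diff[OF K(1)])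
    have "x j = x i + 1 *\<^sub>C d" by (simp add: d_def)
    then have "F (x j) = F (x i) + 2 * Re (s (x i) d - l d) + nsq d"
      using F_step[OF xK d(1), of i 1] by simp
    moreover have "m \<le> F (x i) + Re (s (x i) d - l d) + nsq d / 4"
      using F_step[OF xK d(1), of i "1/2"] m_le[OF Kadd[OF xK d(1), of i "1/2"]]
      by (simp add: norm_divide power_divide diff_divide_distrib)
    ultimately have "nsq d \<le> 2 * (F (x i) - m) + 2 * (F (x j) - m)" by simp
    then show ?thesis
      using x[of i] x[of j] nsq_commute[OF xD xD, of i j] by (simp add: d_def)
  qed
  have inv0: "(\<lambda>n. eps n) \<longlonglongrightarrow> 0"
    unfolding eps_def by (rule LIMSEQ_inverse_real_of_nat)
  have "\<exists>N. \<forall>i\<ge>N. \<forall>j\<ge>N. nsq (x i - x j) < e" if "0 < e" for e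
  proof -
    have "\<forall>\<^sub>F n in sequentially. eps n < e / 4"
      using order_tendstoD(2)[OF inv0, of "e / 4"] that by simp
    then obtain N where N: "\<And>n. n \<ge> N \<Longrightarrow> eps n < e / 4"
      by (auto simp: eventually_sequentially)
    have "nsq (x i - x j) < e" if "i \<ge> N" "j \<ge> N" for i j
      using close[of i j] N[OF that(1)] N[OF that(2)] by (simp add: field_simps)
    then show ?thesis by blast
  qed
  then obtain p where p: "p \<in> D" and lim: "(\<lambda>n. nsq (x n - p)) \<longlonglongrightarrow> 0"
    using complete[of x] xD by blast
  have "s p k = l k" if k: "k \<in> K" for k
  proof -
    define z where "z = s p k - l k"
    have "0 \<le> 0 + 2 * Re (cnj c * z) + (cmod c)\<^sup>2 * nsq k" for c
    proof (rule tendsto_lowerbound)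
      show "(\<lambda>n. eps n + 2 * Re (cnj c * (s (x n) k - l k)) + (cmod c)\<^sup>2 * nsq k)
        \<longlonglongrightarrow> 0 + 2 * Re (cnj c * z) + (cmod c)\<^sup>2 * nsq k"
        unfolding z_def using s_tendsto[OF xD p KD[OF k] lim] by (intro tendsto_intros inv0)
      have "0 \<le> eps n + 2 * Re (cnj c * (s (x n) k - l k)) + (cmod c)\<^sup>2 * nsq k" for n
        using F_step[OF xK k, of n c] m_le[OF Kadd[OF xK k, of n c]] x[of n] by linarith
      then show "\<forall>\<^sub>F n in sequentially. 0 \<le> eps n +
          2 * Re (cnj c * (s (x n) k - l k)) + (cmod c)\<^sup>2 * nsq k"
        by simp
    qed simp
    from complex_square_le_of_quadratic_nonneg[OF this nsq_nonneg[OF KD[OF k]]]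
    show ?thesis by (simp add: z_def)
  qed
  then show ?thesis using p xK lim by blast
qed

end


section \<open>Positive and closed forms\<close>

lemma cinner_add_right: "cinner (w::'a::complex_hilbert) (u + v) = cinner w u + cinner w v"
  using cinner_commute[of w "u + v"] cinner_commute[of w u] cinner_commute[of w v]
  by (simp add: cinner_add_left)

lemma cinner_scaleC_right: "cinner (w::'a::complex_hilbert) (c *\<^sub>C u) = cnj c * cinner w u"
  using cinner_commute[of w "c *\<^sub>C u"] cinner_commute[of w u]
  by (simp add: cinner_scaleC_left)

global_interpretation hilbert: semi_inner "UNIV :: 'a::complex_hilbert set" cinner
proof
  show "sesquilinear_on UNIV (cinner :: 'a \<Rightarrow> 'a \<Rightarrow> complex)"
    unfolding sesquilinear_on_def
    by (simp add: cinner_add_left cinner_scaleC_left cinner_add_right cinner_scaleC_right)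
qed (simp_all add: cinner_self complex_vector.subspace_UNIV del: of_real_power)

lemma quadratic_cinner: "quadratic cinner u = (norm u)\<^sup>2"
  by (simp add: quadratic_def cinner_self del: of_real_power)

lemma cinner_Cauchy_Schwarz: "(cmod (cinner u v))\<^sup>2 \<le> (norm u)\<^sup>2 * (norm v)\<^sup>2"
  using hilbert.Cauchy_Schwarz[of u v] by (simp add: quadratic_cinner)

lemma cinner_tendsto:
  assumes "x \<longlonglongrightarrow> u"
  shows "(\<lambda>n. cinner (x n) v) \<longlonglongrightarrow> cinner u v"
proof (rule hilbert.s_tendsto)
  have "(\<lambda>n. (norm (x n - u))\<^sup>2) \<longlonglongrightarrow> 0\<^sup>2"
    using assms by (intro tendsto_power) (simp add: tendsto_norm_zero_iff LIM_zero_iff)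
  then show "(\<lambda>n. quadratic cinner (x n - u)) \<longlonglongrightarrow> 0"
    by (simp add: quadratic_cinner)
qed auto

lemma eq_if_cinner_eq_on_dense:
  assumes dense: "closure D = (UNIV :: 'a::complex_hilbert set)"
    and eq: "\<And>v. v \<in> D \<Longrightarrow> cinner a v = cinner b v"
  shows "a = b"
proof -
  have "a - b \<in> closure D" using dense by simp
  then obtain x where x: "\<And>n. x n \<in> D" and lim: "x \<longlonglongrightarrow> a - b"
    by (auto simp: closure_sequential)
  have "cinner (x n) (a - b) = 0" for n
    using eq[OF x, of n] hilbert.hermitian[of "x n" "a - b"] by (simp add: hilbert.diff_left)
  then have "cinner (a - b) (a - b) = 0"
    using cinner_tendsto[OF lim, of "a - b"] by (simp add: LIMSEQ_const_iff)
  then show ?thesis by (simp add: cinner_self)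
qed

lemma semi_inner_cong:
  assumes s: "semi_inner D s" and eq: "\<And>u v. u \<in> D \<Longrightarrow> v \<in> D \<Longrightarrow> s' u v = s u v"
  shows "semi_inner D s'"
proof -
  interpret semi_inner D s by (rule s)
  show ?thesis
  proof
    show "sesquilinear_on D s'"
      unfolding sesquilinear_on_def by (simp add: eq expand)
  qed (simp_all add: eq subspace diag_real diag_nonneg)
qed

lemma positive_formI:
  assumes s: "semi_inner D s" and D: "dom Q = D"
    and Q_val: "\<And>u. u \<in> D \<Longrightarrow> the (Q u) = quadratic s u"
  shows "positive_form Q"
    and "\<And>u v. u \<in> D \<Longrightarrow> v \<in> D \<Longrightarrow> sesq Q u v = s u v"
proof -
  interpret semi_inner D s by (rule s)
  show "positive_form Q"
    unfolding positive_form_def D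
    by (intro conjI ballI exI[of _ s] subspace sesquilinear)
      (simp_all add: Q_val nsq_nonneg diag)
  show "sesq Q u v = s u v" if "u \<in> D" "v \<in> D" for u v
    by (rule sesq_eq)
      (use that in \<open>simp_all add: D subspace sesquilinear Q_val diag\<close>)
qed

lemma positive_form_semi_inner:
  assumes "positive_form Q"
  shows "semi_inner (dom Q) (sesq Q)"
    and quadratic_sesq: "u \<in> dom Q \<Longrightarrow> quadratic (sesq Q) u = the (Q u)"
proof -
  from assms obtain s where D: "complex_vector.subspace (dom Q)"
    and s: "sesquilinear_on (dom Q) s"
    and diag: "\<And>u. u \<in> dom Q \<Longrightarrow> s u u = complex_of_real (the (Q u))"
    and nonneg: "\<And>u. u \<in> dom Q \<Longrightarrow> 0 \<le> the (Q u)"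
    unfolding positive_form_def by blast
  have "semi_inner (dom Q) s"
    using D s diag nonneg by unfold_locales simp_all
  then show "semi_inner (dom Q) (sesq Q)"
    by (rule semi_inner_cong) (rule sesq_eq[OF D s diag])
  show "u \<in> dom Q \<Longrightarrow> quadratic (sesq Q) u = the (Q u)"
    by (simp add: quadratic_def sesq_eq[OF D s diag] diag)
qed

text \<open>
  The sesquilinear form of \<open>shift_form Q l\<close>, given directly on all pairs of vectors.
\<close>

definition shift_sesq :: "'a::complex_hilbert form \<Rightarrow> real \<Rightarrow> 'a \<Rightarrow> 'a \<Rightarrow> complex"
  where "shift_sesq Q l u v = sesq Q u v + of_real l * cinner u v"

lemma shift_sesq_semi_inner:
  assumes Q: "positive_form Q" and l: "0 \<le> l"
  shows "semi_inner (dom Q) (shift_sesq Q l)"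
proof -
  interpret semi_inner "dom Q" "sesq Q" by (rule positive_form_semi_inner[OF Q])
  show ?thesis
  proof
    show "sesquilinear_on (dom Q) (shift_sesq Q l)"
      unfolding sesquilinear_on_def
      by (simp add: shift_sesq_def expand hilbert.expand algebra_simps)
  qed (use l in \<open>simp_all add: shift_sesq_def subspace diag_real diag_nonneg cinner_self del: of_real_power\<close>)
qed

lemma quadratic_shift_sesq:
  "positive_form Q \<Longrightarrow> u \<in> dom Q \<Longrightarrow> quadratic (shift_sesq Q l) u = the (Q u) + l * (norm u)\<^sup>2"
  using quadratic_sesq[of Q u]
  by (simp add: quadratic_def shift_sesq_def cinner_self del: of_real_power)

lemma dom_shift_form: "dom (shift_form Q l) = dom Q"
  by (auto simp: shift_form_def dom_def)

lemma the_shift_form: "u \<in> dom Q \<Longrightarrow> the (shift_form Q l u) = the (Q u) + l * (norm u)\<^sup>2"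
  by (auto simp: shift_form_def)

lemma sesq_shift_form:
  assumes "positive_form Q" "0 \<le> l" "u \<in> dom Q" "v \<in> dom Q"
  shows "sesq (shift_form Q l) u v = shift_sesq Q l u v"
  by (rule positive_formI(2)[OF shift_sesq_semi_inner dom_shift_form])
    (use assms in \<open>simp_all add: quadratic_shift_sesq the_shift_form\<close>)

lemma closed_form_positive: "closed_form Q \<Longrightarrow> positive_form Q"
  by (simp add: closed_form_def)

lemma closed_formD:
  assumes "closed_form Q" "\<And>n. x n \<in> dom Q" "x \<longlonglongrightarrow> u"
    "\<forall>e>0. \<exists>N. \<forall>m\<ge>N. \<forall>n\<ge>N. the (Q (x m - x n)) < e"
  shows "u \<in> dom Q" "(\<lambda>n. the (Q (x n - u))) \<longlonglongrightarrow> 0"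
  using assms unfolding closed_form_def by blast+

lemma positive_form_mem:
  assumes "positive_form Q" "u \<in> dom Q" "v \<in> dom Q"
  shows "u + v \<in> dom Q" "u - v \<in> dom Q" "c *\<^sub>C u \<in> dom Q" "0 \<in> dom Q"
proof -
  interpret semi_inner "dom Q" "sesq Q" by (rule positive_form_semi_inner) fact
  show "u + v \<in> dom Q" "u - v \<in> dom Q" "c *\<^sub>C u \<in> dom Q" "0 \<in> dom Q" using assms mem by auto
qed

lemma positive_form_nonneg: "positive_form Q \<Longrightarrow> u \<in> dom Q \<Longrightarrow> 0 \<le> the (Q u)"
  by (simp add: positive_form_def)

text \<open>
  A Cauchy sequence in the shifted form is Cauchy in the norm, because \<open>l > 0\<close>, and then closedness
  of \<open>Q\<close> applies to its limit in the norm.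
\<close>

lemma shift_sesq_complete:
  assumes Q: "closed_form Q" and l: "0 < l"
  shows "complete_inner (dom Q) (shift_sesq Q l)"
proof -
  note pos = closed_form_positive[OF Q]
  interpret semi_inner "dom Q" "shift_sesq Q l"
    using shift_sesq_semi_inner[OF pos] l by simp
  show ?thesis
  proof
    fix x :: "nat \<Rightarrow> _" assume x: "\<And>n. x n \<in> dom Q"
      and cauchy: "\<And>e. 0 < e \<Longrightarrow> \<exists>N. \<forall>m\<ge>N. \<forall>n\<ge>N. nsq (x m - x n) < e"
    have nsq: "nsq (x m - x n) = the (Q (x m - x n)) + l * (norm (x m - x n))\<^sup>2" for m n
      using x by (simp add: quadratic_shift_sesq[OF pos] diff_mem)
    have Q_nonneg: "0 \<le> the (Q (x m - x n))" for m n
      using x by (simp add: positive_form_nonneg[OF pos] diff_mem)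
    have "Cauchy x"
    proof (rule CauchyI)
      fix e :: real assume e: "0 < e"
      obtain N where N: "\<And>m n. m \<ge> N \<Longrightarrow> n \<ge> N \<Longrightarrow> nsq (x m - x n) < l * e\<^sup>2"
        using cauchy[of "l * e\<^sup>2"] e l by auto
      have "norm (x m - x n) < e" if "m \<ge> N" "n \<ge> N" for m n
      proof -
        have "l * (norm (x m - x n))\<^sup>2 < l * e\<^sup>2"
          using N[OF that] Q_nonneg[of m n] by (simp add: nsq)
        then show ?thesis using l e by (simp add: power_less_imp_less_base)
      qed
      then show "\<exists>M. \<forall>m\<ge>M. \<forall>n\<ge>M. norm (x m - x n) < e" by blast
    qed
    then obtain u where u: "x \<longlonglongrightarrow> u"
      by (auto simp: Cauchy_convergent_iff convergent_def)
    have Qc: "\<forall>e>0. \<exists>N. \<forall>m\<ge>N. \<forall>n\<ge>N. the (Q (x m - x n)) < e"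
    proof (intro allI impI)
      fix e :: real assume e: "0 < e"
      have "the (Q (x m - x n)) \<le> nsq (x m - x n)" for m n using l by (simp add: nsq)
      then show "\<exists>N. \<forall>m\<ge>N. \<forall>n\<ge>N. the (Q (x m - x n)) < e"
        using cauchy[OF e] by (meson le_less_trans)
    qed
    note lim = closed_formD[OF Q x u Qc]
    have "(\<lambda>n. the (Q (x n - u)) + l * (norm (x n - u))\<^sup>2) \<longlonglongrightarrow> 0 + l * 0\<^sup>2"
      by (intro tendsto_intros lim(2) tendsto_norm_zero[OF LIM_zero[OF u]])
    then have "(\<lambda>n. nsq (x n - u)) \<longlonglongrightarrow> 0"
      using x lim(1) by (simp add: quadratic_shift_sesq[OF pos] diff_mem)
    then show "\<exists>u\<in>dom Q. (\<lambda>n. nsq (x n - u)) \<longlonglongrightarrow> 0" using lim(1) by blast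
  qed
qed

lemma norm_tendsto_if_shift_sesq_tendsto:
  assumes Q: "positive_form Q" and l: "0 < l" and x: "\<And>n. x n \<in> dom Q" "u \<in> dom Q"
    and lim: "(\<lambda>n. quadratic (shift_sesq Q l) (x n - u)) \<longlonglongrightarrow> 0"
  shows "x \<longlonglongrightarrow> u" "(\<lambda>n. the (Q (x n - u))) \<longlonglongrightarrow> 0"
proof -
  have eq: "quadratic (shift_sesq Q l) (x n - u) = the (Q (x n - u)) + l * (norm (x n - u))\<^sup>2" for n
    using x by (simp add: quadratic_shift_sesq[OF Q] positive_form_mem[OF Q])
  have nn: "0 \<le> the (Q (x n - u))" for n
    using x by (simp add: positive_form_nonneg[OF Q] positive_form_mem[OF Q])
  show "(\<lambda>n. the (Q (x n - u))) \<longlonglongrightarrow> 0"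
    by (rule tendsto_zero_if_norm_le[OF _ lim]) (use nn l in \<open>simp add: eq\<close>)
  have "(\<lambda>n. (norm (x n - u))\<^sup>2) \<longlonglongrightarrow> 0"
  proof (rule tendsto_zero_if_norm_le)
    show "norm ((norm (x n - u))\<^sup>2) \<le> inverse l * quadratic (shift_sesq Q l) (x n - u)" for n
      using nn[of n] l by (simp add: eq field_simps)
    show "(\<lambda>n. inverse l * quadratic (shift_sesq Q l) (x n - u)) \<longlonglongrightarrow> 0"
      by (rule tendsto_mult_right_zero[OF lim])
  qed
  then show "x \<longlonglongrightarrow> u" by (rule tendsto_if_norm_square_tendsto_zero)
qed

lemma shift_sesq_Riesz:
  assumes Q: "closed_form Q" and l: "0 < l"
  shows "\<exists>p\<in>dom Q. \<forall>v\<in>dom Q. shift_sesq Q l p v = cinner f v"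
proof -
  note pos = closed_form_positive[OF Q]
  interpret complete_inner "dom Q" "shift_sesq Q l"
    by (rule shift_sesq_complete[OF Q l])
  have "(cmod (cinner f u))\<^sup>2 \<le> (norm f)\<^sup>2 / l * nsq u" if u: "u \<in> dom Q" for u
  proof -
    have "(norm u)\<^sup>2 \<le> nsq u / l"
      using l positive_form_nonneg[OF pos u] by (simp add: quadratic_shift_sesq[OF pos u] field_simps)
    then have "(norm f)\<^sup>2 * (norm u)\<^sup>2 \<le> (norm f)\<^sup>2 * (nsq u / l)" by (rule mult_left_mono) simp
    then show ?thesis using cinner_Cauchy_Schwarz[of f u] by simp
  qed
  then show ?thesis
    using Riesz_on_subspace[OF subspace order_refl, of "cinner f" "(norm f)\<^sup>2 / l"] l
    by (auto simp: hilbert.expand)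
qed

lemma shift_sesq_eqI:
  assumes Q: "positive_form Q" and l: "0 < l" and "p \<in> dom Q" "p' \<in> dom Q"
    and eq: "\<And>v. v \<in> dom Q \<Longrightarrow> shift_sesq Q l p v = shift_sesq Q l p' v"
  shows "p = p'"
proof -
  interpret semi_inner "dom Q" "shift_sesq Q l"
    using shift_sesq_semi_inner[OF Q] l by simp
  have d: "p - p' \<in> dom Q" using assms by (simp add: mem)
  have "nsq (p - p') = 0"
    using eq[OF d] assms d by (simp add: quadratic_def diff_left)
  then have "l * (norm (p - p'))\<^sup>2 \<le> 0"
    using positive_form_nonneg[OF Q d] by (simp add: quadratic_shift_sesq[OF Q d])
  then show ?thesis using l by (simp add: mult_le_0_iff)
qed


section \<open>Moreau envelopes of a form\<close>

definition moreau_envelope :: "'a::complex_hilbert form \<Rightarrow> real \<Rightarrow> 'a \<Rightarrow> real"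
  where "moreau_envelope Q n f = (INF v\<in>dom Q. the (Q v) + n * (norm (v - f))\<^sup>2)"

lemma moreau_envelope_le:
  assumes nonneg: "\<forall>v\<in>dom Q. 0 \<le> the (Q v)" and "0 \<le> n" "v \<in> dom Q"
  shows "moreau_envelope Q n f \<le> the (Q v) + n * (norm (v - f))\<^sup>2"
  unfolding moreau_envelope_def
  using assms by (intro cINF_lower bdd_belowI2[of _ 0]) auto

lemma moreau_envelope_ge:
  assumes "dom Q \<noteq> {}" "\<And>v. v \<in> dom Q \<Longrightarrow> c \<le> the (Q v) + n * (norm (v - f))\<^sup>2"
  shows "c \<le> moreau_envelope Q n f"
  unfolding moreau_envelope_def using assms by (rule cINF_greatest)

lemma moreau_envelope_approx:
  assumes "dom Q \<noteq> {}" "0 < e"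
  shows "\<exists>v\<in>dom Q. the (Q v) + n * (norm (v - f))\<^sup>2 < moreau_envelope Q n f + e"
  using cInf_lessD[of "(\<lambda>v. the (Q v) + n * (norm (v - f))\<^sup>2) ` dom Q" "moreau_envelope Q n f + e"] assms
  by (auto simp: moreau_envelope_def)

lemma moreau_envelope_mono:
  assumes nonneg: "\<forall>v\<in>dom Q. 0 \<le> the (Q v)" and "dom Q \<noteq> {}" "0 \<le> m" "m \<le> n"
  shows "moreau_envelope Q m f \<le> moreau_envelope Q n f"
proof (rule moreau_envelope_ge)
  fix v assume v: "v \<in> dom Q"
  have "m * (norm (v - f))\<^sup>2 \<le> n * (norm (v - f))\<^sup>2" by (rule mult_right_mono) (use assms in auto)
  then show "moreau_envelope Q m f \<le> the (Q v) + n * (norm (v - f))\<^sup>2"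
    using moreau_envelope_le[OF nonneg, of m v f] assms v by simp
qed fact

text \<open>
  The proximal point, that is the minimiser in \<open>moreau_envelope S n f\<close>, defined by its Euler equation;
  it equals \<open>n (H + n)\<^sup>-\<^sup>1 f\<close> for the operator \<open>H\<close> of \<open>S\<close>.
\<close>

definition prox :: "'a::complex_hilbert form \<Rightarrow> real \<Rightarrow> 'a \<Rightarrow> 'a"
  where "prox S n f = (SOME p. p \<in> dom S \<and> (\<forall>v\<in>dom S. shift_sesq S n p v = of_real n * cinner f v))"

lemma prox:
  assumes "closed_form S" "0 < n"
  shows prox_mem: "prox S n f \<in> dom S"
    and shift_sesq_prox: "v \<in> dom S \<Longrightarrow> shift_sesq S n (prox S n f) v = of_real n * cinner f v"
proof -
  have "\<exists>p. p \<in> dom S \<and> (\<forall>v\<in>dom S. shift_sesq S n p v = of_real n * cinner f v)"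
    using shift_sesq_Riesz[OF assms, of "of_real n *\<^sub>C f"] by (auto simp: cinner_scaleC_left)
  from someI_ex[OF this]
  show "prox S n f \<in> dom S"
    and "v \<in> dom S \<Longrightarrow> shift_sesq S n (prox S n f) v = of_real n * cinner f v"
    by (auto simp: prox_def)
qed

lemma prox_eqI:
  assumes "closed_form S" "0 < n" "p \<in> dom S"
    and "\<And>v. v \<in> dom S \<Longrightarrow> shift_sesq S n p v = of_real n * cinner f v"
  shows "prox S n f = p"
  by (rule shift_sesq_eqI[OF closed_form_positive[OF assms(1)] assms(2) prox_mem[OF assms(1,2)] assms(3)])
    (simp add: shift_sesq_prox[OF assms(1,2)] assms(4))

lemma norm_diff_square:
  "(norm (v - f))\<^sup>2 = (norm v)\<^sup>2 - 2 * Re (cinner f v) + (norm (f::'a::complex_hilbert))\<^sup>2"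
  using hilbert.nsq_diff[of f v] hilbert.nsq_commute[of f v] by (simp add: quadratic_cinner)

text \<open>
  Expanding the square around the solution of the Euler equation leaves no first-order term. This
  gives the minimum and, in \<open>moreau_envelope_gap\<close>, the exact excess over the minimum at every other
  point, which controls the distance from the minimiser.
\<close>

lemma moreau_envelope_attained:
  fixes f :: "'a::complex_hilbert"
  assumes S: "closed_form S" and n: "0 < n"
  defines "p \<equiv> prox S n f"
  shows moreau_envelope_prox: "moreau_envelope S n f = the (S p) + n * (norm (p - f))\<^sup>2"
    and moreau_envelope_gap: "v \<in> dom S \<Longrightarrow> the (S v) + n * (norm (v - f))\<^sup>2 =
      moreau_envelope S n f + the (S (v - p)) + n * (norm (v - p))\<^sup>2"
    and moreau_envelope_inner: "moreau_envelope S n f = n * (norm f)\<^sup>2 - n * Re (cinner f p)"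
proof -
  note pos = closed_form_positive[OF S]
  interpret semi_inner "dom S" "shift_sesq S n"
    using shift_sesq_semi_inner[OF pos] n by simp
  have p: "p \<in> dom S" and orth: "\<And>v. v \<in> dom S \<Longrightarrow> shift_sesq S n p v = of_real n * cinner f v"
    unfolding p_def using prox[OF S n] by auto
  have val: "the (S v) + n * (norm (v - f))\<^sup>2 = nsq v - 2 * n * Re (cinner f v) + n * (norm f)\<^sup>2"
    if "v \<in> dom S" for v
    using that by (simp add: quadratic_shift_sesq[OF pos] norm_diff_square algebra_simps)
  have gap: "the (S v) + n * (norm (v - f))\<^sup>2 =
      the (S p) + n * (norm (p - f))\<^sup>2 + nsq (v - p)" if v: "v \<in> dom S" for v
  proof -
    define d where "d = v - p"
    have d: "d \<in> dom S" "v = p + d" using v p by (simp_all add: d_def mem)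
    have "nsq v = nsq p + 2 * n * Re (cinner f d) + nsq d"
      using d p by (simp add: nsq_add orth)
    then show ?thesis
      using d v p by (simp add: val hilbert.expand algebra_simps)
  qed
  show eq: "moreau_envelope S n f = the (S p) + n * (norm (p - f))\<^sup>2"
  proof (rule antisym)
    show "moreau_envelope S n f \<le> the (S p) + n * (norm (p - f))\<^sup>2"
      using n p by (intro moreau_envelope_le ballI positive_form_nonneg[OF pos]) simp_all
    show "the (S p) + n * (norm (p - f))\<^sup>2 \<le> moreau_envelope S n f"
    proof (rule moreau_envelope_ge)
      fix v assume v: "v \<in> dom S"
      show "the (S p) + n * (norm (p - f))\<^sup>2 \<le> the (S v) + n * (norm (v - f))\<^sup>2"
        using gap[OF v] nsq_nonneg[of "v - p"] v p by (simp add: diff_mem)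
    qed (use p in auto)
  qed
  show "v \<in> dom S \<Longrightarrow> the (S v) + n * (norm (v - f))\<^sup>2 =
      moreau_envelope S n f + the (S (v - p)) + n * (norm (v - p))\<^sup>2"
    using gap[of v] p eq by (simp add: quadratic_shift_sesq[OF pos] mem)
  have "nsq p = n * Re (cinner f p)"
    using orth[OF p] by (simp add: quadratic_def)
  then show "moreau_envelope S n f = n * (norm f)\<^sup>2 - n * Re (cinner f p)"
    by (simp add: eq val[OF p])
qed

text \<open>
  The value of the envelope is \<open>n\<langle>f - p\<^sub>f, f\<rangle>\<close>, where the proximal point \<open>p\<^sub>f\<close> is linear in \<open>f\<close> because
  the Euler equation is.
\<close>

lemma moreau_envelope_positive_form:
  assumes S: "closed_form S" and n: "0 < n"
  shows "positive_form (\<lambda>f. Some (moreau_envelope S n f))"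
proof (rule positive_formI(1))
  note pos = closed_form_positive[OF S]
  interpret semi_inner "dom S" "shift_sesq S n"
    using shift_sesq_semi_inner[OF pos] n by simp
  note orth = prox[OF S n]
  define b where "b f g = of_real n * (cinner f g - cinner (prox S n f) g)" for f g
  have add: "prox S n (f + g) = prox S n f + prox S n g" for f g
    by (rule prox_eqI[OF S n]) (simp_all add: orth expand cinner_add_left algebra_simps)
  have scale: "prox S n (c *\<^sub>C f) = c *\<^sub>C prox S n f" for f c
    by (rule prox_eqI[OF S n]) (simp_all add: orth expand cinner_scaleC_left algebra_simps)
  have real: "Im (cinner (prox S n f) f) = 0" for f
    using diag_real[OF prox_mem[OF S n], of f] shift_sesq_prox[OF S n prox_mem[OF S n], of f f] n
      hilbert.hermitian[of f "prox S n f"] by simp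
  have re: "Re (cinner (prox S n f) f) = Re (cinner f (prox S n f))" for f
    using hilbert.hermitian[of f "prox S n f"] by simp
  have quad: "moreau_envelope S n f = quadratic b f" for f
    using moreau_envelope_inner[OF S n, of f]
    by (simp add: quadratic_def b_def cinner_self re algebra_simps del: of_real_power)
  show "semi_inner UNIV b"
  proof
    show "sesquilinear_on UNIV b"
      unfolding sesquilinear_on_def b_def
      by (simp add: add scale hilbert.expand algebra_simps)
    show "Im (b f f) = 0" for f
      using real by (simp add: b_def cinner_self del: of_real_power)
    have "0 \<le> moreau_envelope S n f" for f
      by (rule moreau_envelope_ge)
        (use orth n positive_form_nonneg[OF pos] in \<open>auto intro!: add_nonneg_nonneg\<close>)
    then show "0 \<le> Re (b f f)" for f by (simp add: quad[unfolded quadratic_def])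
  qed (simp add: complex_vector.subspace_UNIV)
  show "dom (\<lambda>f. Some (moreau_envelope S n f)) = UNIV" by auto
  show "the (Some (moreau_envelope S n u)) = quadratic b u" for u by (simp add: quad)
qed

text \<open>
  By polarization the sesquilinear forms converge as well, and sesquilinearity passes to the limit.
\<close>

lemma positive_form_limit:
  assumes A: "\<And>k::nat. positive_form (A k)" and D: "complex_vector.subspace D"
    and sub: "\<And>k. D \<subseteq> dom (A k)"
    and lim: "\<And>u. u \<in> D \<Longrightarrow> (\<lambda>k. the (A k u)) \<longlonglongrightarrow> a u"
  shows "positive_form (\<lambda>u. if u \<in> D then Some (a u) else None)" (is "positive_form ?B")
proof (rule positive_formI(1))
  have inn: "semi_inner (dom (A k)) (sesq (A k))" for k
    by (rule positive_form_semi_inner[OF A])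
  have DA: "u \<in> dom (A k)" if "u \<in> D" for u k using that sub by blast
  have scale: "c *\<^sub>C u \<in> D" if "u \<in> D" for c u
    using D that by (rule complex_vector.subspace_scale)
  have add: "u + v \<in> D" if "u \<in> D" "v \<in> D" for u v
    using D that by (rule complex_vector.subspace_add)
  have lims: "(\<lambda>k. sesq (A k) u v) \<longlonglongrightarrow> sesq ?B u v" if "u \<in> D" "v \<in> D" for u v
    unfolding sesq_def
  proof (intro tendsto_intros)
    fix j :: nat
    have mem: "u + \<i> ^ j *\<^sub>C v \<in> D" using that by (intro add scale)
    then show "(\<lambda>k. the (A k (u + \<i> ^ j *\<^sub>C v))) \<longlonglongrightarrow> the (?B (u + \<i> ^ j *\<^sub>C v))"
      using lim[OF mem] by simp
  qed auto
  have diag: "sesq ?B u u = of_real (a u)" if u: "u \<in> D" for u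
  proof -
    have "sesq (A k) u u = of_real (the (A k u))" for k
      using semi_inner.diag[OF inn DA[OF u]] quadratic_sesq[OF A DA[OF u]] by simp
    then have "(\<lambda>k. sesq (A k) u u) \<longlonglongrightarrow> of_real (a u)"
      using tendsto_of_real[OF lim[OF u]] by simp
    then show ?thesis using lims[OF u u] LIMSEQ_unique by blast
  qed
  show "semi_inner D (sesq ?B)"
  proof
    show "sesquilinear_on D (sesq ?B)"
      unfolding sesquilinear_on_def
    proof (intro conjI ballI allI)
      fix u v w assume uvw: "u \<in> D" "v \<in> D" "w \<in> D"
      show "sesq ?B (u + v) w = sesq ?B u w + sesq ?B v w"
        by (rule LIMSEQ_unique[OF lims[OF add[OF uvw(1,2)] uvw(3)]])
          (use tendsto_add[OF lims[OF uvw(1,3)] lims[OF uvw(2,3)]] uvw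
            in \<open>simp add: semi_inner.add_left[OF inn] DA\<close>)
      show "sesq ?B w (u + v) = sesq ?B w u + sesq ?B w v"
        by (rule LIMSEQ_unique[OF lims[OF uvw(3) add[OF uvw(1,2)]]])
          (use tendsto_add[OF lims[OF uvw(3,1)] lims[OF uvw(3,2)]] uvw
            in \<open>simp add: semi_inner.add_right[OF inn] DA\<close>)
    next
      fix c u v assume uv: "u \<in> D" "v \<in> D"
      show "sesq ?B (c *\<^sub>C u) v = c * sesq ?B u v"
        by (rule LIMSEQ_unique[OF lims[OF scale[OF uv(1)] uv(2)]])
          (use tendsto_mult_left[OF lims[OF uv]] uv in \<open>simp add: semi_inner.scale_left[OF inn] DA\<close>)
      show "sesq ?B u (c *\<^sub>C v) = cnj c * sesq ?B u v"
        by (rule LIMSEQ_unique[OF lims[OF uv(1) scale[OF uv(2)]]])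
          (use tendsto_mult_left[OF lims[OF uv]] uv in \<open>simp add: semi_inner.scale_right[OF inn] DA\<close>)
    qed
    show "0 \<le> Re (sesq ?B u u)" if u: "u \<in> D" for u
    proof -
      have "0 \<le> a u"
        by (rule LIMSEQ_le_const[OF lim[OF u]]) (use positive_form_nonneg[OF A DA[OF u]] in auto)
      then show ?thesis by (simp add: diag[OF u])
    qed
  qed (simp_all add: D diag)
  show "dom ?B = D" by (auto simp: dom_def)
  show "the (?B u) = quadratic (sesq ?B) u" if "u \<in> D" for u
    using that by (simp add: quadratic_def diag)
qed

text \<open>
  A closed form is at most the supremum of its Moreau envelopes. By the exact excess formula the
  proximal points satisfy \<open>S[p\<^sub>j - p\<^sub>i] \<le> a\<^sub>j - a\<^sub>i\<close> for \<open>i \<le> j\<close>, where the values \<open>a\<^sub>k\<close> of the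
  envelopes increase and are bounded; so the \<open>p\<^sub>k\<close> are Cauchy in the form, while they converge to
  \<open>f\<close> in the norm.
\<close>

lemma closed_form_bounded_envelope:
  assumes S: "closed_form S" and bound: "\<And>k. moreau_envelope S (real (Suc k)) f \<le> C"
  shows "f \<in> dom S \<and> the (S f) \<le> C"
proof -
  note pos = closed_form_positive[OF S]
  define p where "p k = prox S (real (Suc k)) f" for k
  define a where "a k = moreau_envelope S (real (Suc k)) f" for k
  have p: "p k \<in> dom S" for k unfolding p_def by (rule prox_mem[OF S]) simp
  have a: "a k = the (S (p k)) + real (Suc k) * (norm (p k - f))\<^sup>2" for k
    unfolding a_def p_def by (rule moreau_envelope_prox[OF S]) simp
  have mono: "a i \<le> a j" if "i \<le> j" for i j
    unfolding a_def using p that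
    by (intro moreau_envelope_mono ballI positive_form_nonneg[OF pos]) auto
  have ge0: "0 \<le> the (S (p k))" for k by (rule positive_form_nonneg[OF pos p])
  have diff: "the (S (p j - p i)) \<le> a j - a i" if "i \<le> j" for i j
  proof -
    have "the (S (p j)) + real (Suc i) * (norm (p j - f))\<^sup>2 =
        a i + the (S (p j - p i)) + real (Suc i) * (norm (p j - p i))\<^sup>2"
      unfolding a_def p_def by (rule moreau_envelope_gap[OF S]) (use p in \<open>simp_all add: p_def\<close>)
    moreover have "real (Suc i) * (norm (p j - f))\<^sup>2 \<le> real (Suc j) * (norm (p j - f))\<^sup>2"
      by (rule mult_right_mono) (use that in auto)
    moreover have "0 \<le> real (Suc i) * (norm (p j - p i))\<^sup>2" by simp
    ultimately show ?thesis using a[of j] by linarith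
  qed
  have "incseq a" using mono by (simp add: incseq_def)
  then have "Cauchy a"
    using bound incseq_convergent[of a C] unfolding a_def
    by (metis convergent_Cauchy convergentI)
  have cauchy: "\<forall>e>0. \<exists>N. \<forall>m\<ge>N. \<forall>n\<ge>N. the (S (p m - p n)) < e"
  proof (intro allI impI)
    fix e :: real assume e: "0 < e"
    obtain N where N: "\<And>m n. m \<ge> N \<Longrightarrow> n \<ge> N \<Longrightarrow> \<bar>a m - a n\<bar> < e"
      using CauchyD[OF \<open>Cauchy a\<close> e] by auto
    have "the (S (p m - p n)) < e" if "m \<ge> N" "n \<ge> N" for m n
    proof (cases "n \<le> m")
      case True
      then show ?thesis using diff[OF True] N[OF that] by linarith
    next
      case False
      have "the (S (p m - p n)) = the (S (p n - p m))"
        using semi_inner.nsq_commute[OF positive_form_semi_inner(1)[OF pos] p p, of m n]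
        by (simp add: quadratic_sesq[OF pos] positive_form_mem[OF pos] p)
      then show ?thesis using diff[of m n] N[OF that] False by linarith
    qed
    then show "\<exists>N. \<forall>m\<ge>N. \<forall>n\<ge>N. the (S (p m - p n)) < e" by blast
  qed
  have p_lim: "p \<longlonglongrightarrow> f"
  proof -
    have "(norm (p k - f))\<^sup>2 \<le> C * inverse (real (Suc k))" for k
      using bound[of k] ge0[of k] a[of k] unfolding a_def by (simp add: field_simps)
    then have "(\<lambda>k. (norm (p k - f))\<^sup>2) \<longlonglongrightarrow> 0"
      by (intro tendsto_zero_if_norm_le[OF _ tendsto_mult_right_zero[OF LIMSEQ_inverse_real_of_nat]]) auto
    then show ?thesis by (rule tendsto_if_norm_square_tendsto_zero)
  qed
  note f = closed_formD(1)[OF S p p_lim cauchy] and lim = closed_formD(2)[OF S p p_lim cauchy]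
  have "(\<lambda>n. the (S (p n))) \<longlonglongrightarrow> the (S f)"
    using semi_inner.nsq_tendsto[OF positive_form_semi_inner(1)[OF pos] p f] lim
    by (simp add: quadratic_sesq[OF pos] positive_form_mem[OF pos] p f)
  moreover have "the (S (p n)) \<le> C" for n
  proof -
    have "0 \<le> real (Suc n) * (norm (p n - f))\<^sup>2" by simp
    then show ?thesis using a[of n] bound[of n] unfolding a_def by linarith
  qed
  ultimately show ?thesis using f LIMSEQ_le_const2 by blast
qed

text \<open>
  A sequence that converges in the form norm of \<open>T\<close>, and along which \<open>S\<close> and \<open>T\<close> agree, is Cauchy for
  \<open>S\<close>; so both forms have the same value at the limit. This is how inclusions between closed forms
  follow from a core.
\<close>

lemma closed_form_extends_from_core:
  assumes T: "positive_form T" and S: "closed_form S"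
    and x: "\<And>n::nat. x n \<in> dom T" "x \<longlonglongrightarrow> f" and f: "f \<in> dom T"
    and lim: "(\<lambda>n. the (T (x n - f))) \<longlonglongrightarrow> 0"
    and S_x: "\<And>n. x n \<in> dom S" "\<And>n. the (S (x n)) = the (T (x n))"
    and S_diff: "\<And>m n. the (S (x m - x n)) = the (T (x m - x n))"
  shows "S f = T f"
proof -
  note pos = closed_form_positive[OF S]
  interpret T: semi_inner "dom T" "sesq T" by (rule positive_form_semi_inner[OF T])
  interpret S: semi_inner "dom S" "sesq S" by (rule positive_form_semi_inner[OF pos])
  have T_lim: "(\<lambda>n. T.nsq (x n - f)) \<longlonglongrightarrow> 0"
    using lim x f by (simp add: quadratic_sesq[OF T] T.mem)
  have cauchy: "\<forall>e>0. \<exists>N. \<forall>m\<ge>N. \<forall>n\<ge>N. the (S (x m - x n)) < e"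
    using T.Cauchy_nsq[OF x(1) f T_lim] x by (simp add: S_diff quadratic_sesq[OF T] T.mem)
  note fS = closed_formD(1)[OF S S_x(1) x(2) cauchy]
    and S_lim = closed_formD(2)[OF S S_x(1) x(2) cauchy]
  have "(\<lambda>n. S.nsq (x n)) \<longlonglongrightarrow> S.nsq f"
    by (rule S.nsq_tendsto[OF S_x(1) fS]) (use S_lim S_x(1) fS in \<open>simp add: quadratic_sesq[OF pos] S.mem\<close>)
  then have "(\<lambda>n. the (T (x n))) \<longlonglongrightarrow> the (S f)"
    using S_x fS by (simp add: quadratic_sesq[OF pos])
  moreover have "(\<lambda>n. the (T (x n))) \<longlonglongrightarrow> the (T f)"
    using T.nsq_tendsto[OF x(1) f T_lim] x f by (simp add: quadratic_sesq[OF T])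
  ultimately have "the (S f) = the (T f)" by (rule LIMSEQ_unique)
  then show ?thesis using f fS by auto
qed


section \<open>Limits of closed forms from above\<close>

lemma positive_form_restrict:
  assumes Q: "positive_form Q" and D: "complex_vector.subspace D" "D \<subseteq> dom Q"
  shows "positive_form (Q |` D)"
proof (rule positive_formI(1))
  interpret semi_inner "dom Q" "sesq Q" by (rule positive_form_semi_inner[OF Q])
  have DQ: "u \<in> dom Q" if "u \<in> D" for u using that D by blast
  show "semi_inner D (sesq Q)"
  proof
    show "sesquilinear_on D (sesq Q)"
      unfolding sesquilinear_on_def by (simp add: expand DQ)
  qed (simp_all add: D diag_real diag_nonneg DQ)
  show "dom (Q |` D) = D" using D by auto
  show "the ((Q |` D) u) = quadratic (sesq Q) u" if "u \<in> D" for u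
    using that DQ by (simp add: quadratic_sesq[OF Q])
qed

text \<open>
  The lower semicontinuous envelope of \<open>Q\<close>, as the supremum of the Moreau envelopes. Integer
  parameters suffice by monotonicity; \<open>Suc k\<close> keeps them positive.
\<close>

definition relaxation :: "'a::complex_hilbert form \<Rightarrow> 'a form"
  where "relaxation Q f =
    (if bdd_above (range (\<lambda>k. moreau_envelope Q (real (Suc k)) f))
     then Some (SUP k. moreau_envelope Q (real (Suc k)) f) else None)"

text \<open>
  The form \<open>Q\<close>, possibly not closable, as a limit from above of closed forms: this is the situation of
  the approximating traces and the harmonic form.
\<close>

locale closed_approximation =
  fixes Q :: "'a::complex_hilbert form" and q :: "real \<Rightarrow> 'a form"
  assumes dense: "closure (dom Q) = UNIV"
    and q_closed: "0 < l \<Longrightarrow> closed_form (q l)"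
    and dom_q: "0 < l \<Longrightarrow> dom (q l) = dom Q"
    and q_ge: "0 < l \<Longrightarrow> f \<in> dom Q \<Longrightarrow> the (Q f) \<le> the (q l f)"
    and q_lim: "f \<in> dom Q \<Longrightarrow> ((\<lambda>l. the (q l f)) \<longlongrightarrow> the (Q f)) (at_right 0)"
begin

lemma inverse_at_right: "filterlim (\<lambda>k. inverse (real (Suc k))) (at_right 0) sequentially"
  unfolding filterlim_at using LIMSEQ_inverse_real_of_nat by (simp del: of_nat_Suc)

lemma subspace_Q: "complex_vector.subspace (dom Q)"
  using q_closed[of 1] dom_q[of 1] by (simp add: closed_form_def positive_form_def)

lemma positive_Q: "positive_form Q"
proof -
  have "positive_form (\<lambda>u. if u \<in> dom Q then Some (the (Q u)) else None)"
  proof (rule positive_form_limit[where A = "\<lambda>k. q (inverse (real (Suc k)))"])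
    show "(\<lambda>k. the (q (inverse (real (Suc k))) u)) \<longlonglongrightarrow> the (Q u)" if "u \<in> dom Q" for u
      by (rule filterlim_compose[OF q_lim[OF that] inverse_at_right])
  qed (simp_all add: subspace_Q dom_q closed_form_positive[OF q_closed])
  moreover have "(\<lambda>u. if u \<in> dom Q then Some (the (Q u)) else None) = Q"
    by (rule ext) (auto simp: dom_def)
  ultimately show ?thesis by simp
qed

lemma Q_nonneg: "\<forall>v\<in>dom Q. 0 \<le> the (Q v)"
  using positive_form_nonneg[OF positive_Q] by blast

lemma dom_Q_ne: "dom Q \<noteq> {}"
  using complex_vector.subspace_0[OF subspace_Q] by (rule ex_in_conv[THEN iffD1, OF exI])

text \<open>
  The envelopes of \<open>q l\<close> stay above that of \<open>Q\<close>; testing with an almost minimising \<open>v\<close> for \<open>Q\<close>, at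
  which \<open>q l\<close> converges, bounds them from above.
\<close>

lemma moreau_envelope_tendsto:
  assumes n: "0 \<le> n"
  shows "((\<lambda>l. moreau_envelope (q l) n f) \<longlongrightarrow> moreau_envelope Q n f) (at_right 0)"
proof (rule order_tendstoI)
  fix a assume a: "a < moreau_envelope Q n f"
  have "a < moreau_envelope (q l) n f" if l: "0 < l" for l
  proof -
    have "moreau_envelope Q n f \<le> moreau_envelope (q l) n f"
    proof (rule moreau_envelope_ge)
      fix v assume "v \<in> dom (q l)"
      then have v: "v \<in> dom Q" using l by (simp add: dom_q)
      show "moreau_envelope Q n f \<le> the (q l v) + n * (norm (v - f))\<^sup>2"
        using moreau_envelope_le[OF Q_nonneg n v, of f] q_ge[OF l v] by simp
    qed (use dom_q[OF l] dom_Q_ne in metis)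
    then show ?thesis using a by simp
  qed
  then show "\<forall>\<^sub>F l in at_right 0. a < moreau_envelope (q l) n f"
    using eventually_at_right_less by (rule eventually_mono[rotated])
next
  fix a assume a: "moreau_envelope Q n f < a"
  then obtain v where v: "v \<in> dom Q" and less: "the (Q v) + n * (norm (v - f))\<^sup>2 < a"
    using moreau_envelope_approx[OF dom_Q_ne, of "a - moreau_envelope Q n f" n f] by auto
  have "((\<lambda>l. the (q l v) + n * (norm (v - f))\<^sup>2) \<longlongrightarrow> the (Q v) + n * (norm (v - f))\<^sup>2) (at_right 0)"
    by (intro tendsto_intros q_lim v)
  from order_tendstoD(2)[OF this less] eventually_at_right_less[of 0]
  show "\<forall>\<^sub>F l in at_right 0. moreau_envelope (q l) n f < a"
  proof eventually_elim
    case (elim l)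
    have "moreau_envelope (q l) n f \<le> the (q l v) + n * (norm (v - f))\<^sup>2"
      using n v elim q_closed[OF elim(2)]
      by (intro moreau_envelope_le ballI positive_form_nonneg[OF closed_form_positive]) (simp_all add: dom_q)
    then show ?case using elim by simp
  qed
qed

text \<open>
  The infimum for \<open>Q\<close> itself may not be attained, so that its quadratic dependence on \<open>f\<close> is obtained
  from the envelopes of the closed forms \<open>q l\<close>.
\<close>

lemma moreau_envelope_form:
  assumes n: "0 < n"
  shows "positive_form (\<lambda>f. Some (moreau_envelope Q n f))"
proof -
  have "positive_form (\<lambda>f. if f \<in> UNIV then Some (moreau_envelope Q n f) else None)"
  proof (rule positive_form_limit[where A = "\<lambda>k f. Some (moreau_envelope (q (inverse (real (Suc k)))) n f)"])
    show "(\<lambda>k. the (Some (moreau_envelope (q (inverse (real (Suc k)))) n f)))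
        \<longlonglongrightarrow> moreau_envelope Q n f" for f
      using filterlim_compose[OF moreau_envelope_tendsto inverse_at_right] n by simp
  qed (auto simp: complex_vector.subspace_UNIV intro!: moreau_envelope_positive_form q_closed n)
  then show ?thesis by simp
qed

definition M :: "nat \<Rightarrow> 'a \<Rightarrow> real"
  where "M k f = moreau_envelope Q (real (Suc k)) f"

abbreviation T :: "'a form" where "T \<equiv> relaxation Q"

lemma M_form: "positive_form (\<lambda>f. Some (M k f))"
  unfolding M_def by (rule moreau_envelope_form) simp

lemma M_semi_inner: "semi_inner UNIV (sesq (\<lambda>f. Some (M k f)))"
  and quadratic_M: "quadratic (sesq (\<lambda>f. Some (M k f))) f = M k f"
proof -
  have dom: "dom (\<lambda>f. Some (M k f)) = UNIV" by auto
  show "semi_inner UNIV (sesq (\<lambda>f. Some (M k f)))"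
    using positive_form_semi_inner[OF M_form] dom by simp
  show "quadratic (sesq (\<lambda>f. Some (M k f))) f = M k f"
    using quadratic_sesq[OF M_form, of f] dom by simp
qed

lemma M_scale: "M k (c *\<^sub>C f) = (cmod c)\<^sup>2 * M k f"
  using semi_inner.nsq_scale[OF M_semi_inner, of f k c] by (simp add: quadratic_M)

lemma M_parallelogram: "M k (f + g) + M k (f - g) = 2 * M k f + 2 * M k g"
  using semi_inner.parallelogram[OF M_semi_inner, of f g k] by (simp add: quadratic_M)

lemma M_nonneg: "0 \<le> M k f"
  using semi_inner.nsq_nonneg[OF M_semi_inner, of f k] by (simp add: quadratic_M)

lemma M_le_norm: "M k f \<le> real (Suc k) * (norm f)\<^sup>2"
proof -
  interpret semi_inner "dom Q" "sesq Q" by (rule positive_form_semi_inner[OF positive_Q])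
  have "the (Q 0) = 0" using nsq_zero quadratic_sesq[OF positive_Q zero_mem] by simp
  then show ?thesis
    using moreau_envelope_le[OF Q_nonneg, of "real (Suc k)" 0 f] zero_mem by (simp add: M_def)
qed

lemma M_tendsto:
  assumes "x \<longlonglongrightarrow> u"
  shows "(\<lambda>j. M k (x j)) \<longlonglongrightarrow> M k u"
proof -
  have "(\<lambda>j. real (Suc k) * (norm (x j - u))\<^sup>2) \<longlonglongrightarrow> real (Suc k) * 0\<^sup>2"
    by (intro tendsto_intros tendsto_norm_zero[OF LIM_zero[OF assms]])
  then have "(\<lambda>j. real (Suc k) * (norm (x j - u))\<^sup>2) \<longlonglongrightarrow> 0" by simp
  then have "(\<lambda>j. M k (x j - u)) \<longlonglongrightarrow> 0"
    by (rule tendsto_zero_if_norm_le[rotated]) (use M_le_norm M_nonneg in simp)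
  then show ?thesis
    using semi_inner.nsq_tendsto[OF M_semi_inner, of x u k] by (simp add: quadratic_M)
qed

lemma M_mono: "i \<le> j \<Longrightarrow> M i f \<le> M j f"
  unfolding M_def by (rule moreau_envelope_mono[OF Q_nonneg dom_Q_ne]) simp_all

lemma T_mem_iff: "f \<in> dom T \<longleftrightarrow> bdd_above (range (\<lambda>k. M k f))"
  by (auto simp: relaxation_def dom_def M_def)

lemma M_tendsto_T:
  assumes "f \<in> dom T"
  shows "(\<lambda>k. M k f) \<longlonglongrightarrow> the (T f)"
  using assms LIMSEQ_incseq_SUP[of "\<lambda>k. M k f"] M_mono
  by (simp add: T_mem_iff relaxation_def incseq_def M_def)

lemma M_le_T: "f \<in> dom T \<Longrightarrow> M k f \<le> the (T f)"
  using incseq_le[OF _ M_tendsto_T, of f k] M_mono by (simp add: incseq_def)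

lemma T_leI:
  assumes "\<And>k. M k f \<le> C"
  shows "f \<in> dom T" "the (T f) \<le> C"
proof -
  show mem: "f \<in> dom T" unfolding T_mem_iff using assms by (intro bdd_aboveI2)
  show "the (T f) \<le> C" by (rule LIMSEQ_le_const2[OF M_tendsto_T[OF mem]]) (use assms in blast)
qed

lemma T_le_Q:
  assumes f: "f \<in> dom Q"
  shows "f \<in> dom T" "the (T f) \<le> the (Q f)"
proof -
  have "M k f \<le> the (Q f)" for k
    using moreau_envelope_le[OF Q_nonneg _ f, of "real (Suc k)" f] by (simp add: M_def)
  then show "f \<in> dom T" "the (T f) \<le> the (Q f)" using T_leI by blast+
qed

lemma subspace_T: "complex_vector.subspace (dom T)"
  unfolding complex_vector.subspace_def
proof (intro conjI ballI allI)
  show "0 \<in> dom T" using T_le_Q complex_vector.subspace_0[OF subspace_Q] by blast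
next
  fix f g assume fg: "f \<in> dom T" "g \<in> dom T"
  have "M k (f + g) \<le> 2 * the (T f) + 2 * the (T g)" for k
    using M_parallelogram[of k f g] M_nonneg[of k "f - g"] M_le_T[OF fg(1), of k] M_le_T[OF fg(2), of k]
    by linarith
  then show "f + g \<in> dom T" by (rule T_leI)
next
  fix c f assume f: "f \<in> dom T"
  have "M k (c *\<^sub>C f) \<le> (cmod c)\<^sup>2 * the (T f)" for k
    unfolding M_scale using M_le_T[OF f] by (rule mult_left_mono) simp
  then show "c *\<^sub>C f \<in> dom T" by (rule T_leI)
qed

lemma positive_T: "positive_form T"
proof -
  have "positive_form (\<lambda>u. if u \<in> dom T then Some (the (T u)) else None)"
    by (rule positive_form_limit[where A = "\<lambda>k f. Some (M k f)"])
      (auto simp: subspace_T M_tendsto_T intro!: M_form)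
  moreover have "(\<lambda>u. if u \<in> dom T then Some (the (T u)) else None) = T"
    by (rule ext) (auto simp: dom_def)
  ultimately show ?thesis by simp
qed

text \<open>
  Lower semicontinuity of \<open>T\<close> along \<open>y - x m\<close>, inherited from the continuity of each \<open>M k\<close>.
\<close>

lemma T_diff_le:
  assumes x: "\<And>n. x n \<in> dom T" "x \<longlonglongrightarrow> u" and N: "\<And>m. m \<ge> N \<Longrightarrow> the (T (y - x m)) < e"
    and y: "y \<in> dom T"
  shows "y - u \<in> dom T" "the (T (y - u)) \<le> e"
proof -
  have "M k (y - u) \<le> e" for k
  proof (rule LIMSEQ_le_const2)
    show "(\<lambda>m. M k (y - x m)) \<longlonglongrightarrow> M k (y - u)"
      by (intro M_tendsto tendsto_intros x(2))
    have "M k (y - x m) \<le> e" if "m \<ge> N" for m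
      using N[OF that] M_le_T[of "y - x m" k] positive_form_mem(2)[OF positive_T y x(1), of m] by simp
    then show "\<exists>N. \<forall>m\<ge>N. M k (y - x m) \<le> e" by blast
  qed
  then show "y - u \<in> dom T" "the (T (y - u)) \<le> e" using T_leI by blast+
qed

lemma closed_T: "closed_form T"
  unfolding closed_form_def
proof (intro conjI allI impI)
  show "positive_form T" by (rule positive_T)
  fix x u
  assume "(\<forall>n. x n \<in> dom T) \<and> x \<longlonglongrightarrow> u \<and>
    (\<forall>e>0. \<exists>N. \<forall>m\<ge>N. \<forall>n\<ge>N. the (T (x m - x n)) < e)"
  then have x: "\<And>n. x n \<in> dom T" "x \<longlonglongrightarrow> u"
    and cauchy: "\<And>e. 0 < e \<Longrightarrow> \<exists>N. \<forall>m\<ge>N. \<forall>n\<ge>N. the (T (x m - x n)) < e"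
    by auto
  have small: "\<exists>N. \<forall>n\<ge>N. x n - u \<in> dom T \<and> the (T (x n - u)) \<le> e" if "0 < e" for e
    using cauchy[OF that] T_diff_le[OF x _ x(1)] by meson
  \<comment> \<open>Membership of \<open>u\<close> itself follows from that of a single difference.\<close>
  obtain N where "x N - u \<in> dom T" using small[of 1] by fastforce
  then have "x N - (x N - u) \<in> dom T" by (rule positive_form_mem(2)[OF positive_T x(1)])
  then show u: "u \<in> dom T" by simp
  show "(\<lambda>n. the (T (x n - u))) \<longlonglongrightarrow> 0"
  proof (rule LIMSEQ_I)
    fix e :: real assume e: "0 < e"
    obtain N where N: "\<And>n. n \<ge> N \<Longrightarrow> the (T (x n - u)) \<le> e / 2" using small[of "e / 2"] e by auto
    have "norm (the (T (x n - u)) - 0) < e" if "n \<ge> N" for n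
      using N[OF that] e positive_form_nonneg[OF positive_T positive_form_mem(2)[OF positive_T x(1) u], of n]
      by simp
    then show "\<exists>N. \<forall>n\<ge>N. norm (the (T (x n - u)) - 0) < e" by blast
  qed
qed

lemma dense_T: "densely_defined T"
proof -
  have "dom Q \<subseteq> dom T" using T_le_Q by blast
  then show ?thesis using dense closure_mono[of "dom Q" "dom T"] by (auto simp: densely_defined_def)
qed

text \<open>
  A closed extension \<open>S\<close> of \<open>R\<close> lies below \<open>Q\<close> on \<open>dom Q\<close>, hence so do its envelopes below those of
  \<open>Q\<close>, which are at most \<open>T\<close>; and \<open>S\<close> is recovered from its envelopes.
\<close>

lemma minorant_le_T:
  assumes R: "minorant Q R" and f: "f \<in> dom Q"
  shows "the (R f) \<le> the (T f)"
proof -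
  from R obtain S where S: "closed_form S" and RS: "R \<subseteq>\<^sub>m S" and dom: "dom R = dom Q"
    and le: "\<And>u. u \<in> dom Q \<Longrightarrow> the (R u) \<le> the (Q u)"
    unfolding minorant_def closable_form_def by blast
  have eq: "R u = S u" if "u \<in> dom Q" for u
    using RS that dom by (auto simp: map_le_def)
  have "moreau_envelope S (real (Suc k)) f \<le> the (T f)" for k
  proof (rule order_trans[OF _ M_le_T[OF T_le_Q(1)[OF f]]])
    show "moreau_envelope S (real (Suc k)) f \<le> M k f"
      unfolding M_def
    proof (rule moreau_envelope_ge[OF dom_Q_ne])
      fix v assume v: "v \<in> dom Q"
      have "v \<in> dom R" using v dom by simp
      then have "v \<in> dom S" unfolding domIff eq[OF v] .
      then have "moreau_envelope S (real (Suc k)) f \<le> the (S v) + real (Suc k) * (norm (v - f))\<^sup>2"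
        by (intro moreau_envelope_le ballI positive_form_nonneg[OF closed_form_positive[OF S]]) simp_all
      then show "moreau_envelope S (real (Suc k)) f \<le> the (Q v) + real (Suc k) * (norm (v - f))\<^sup>2"
        using le[OF v] eq[OF v] by simp
    qed
  qed
  from closed_form_bounded_envelope[OF S this] show ?thesis using eq[OF f] by simp
qed

lemma dom_restrict_T: "dom (T |` dom Q) = dom Q"
  using T_le_Q(1) by auto

lemma minorant_T: "minorant Q (T |` dom Q)"
  unfolding minorant_def closable_form_def
proof (intro conjI exI[of _ T] ballI)
  show "positive_form (T |` dom Q)"
    using T_le_Q(1) by (intro positive_form_restrict positive_T subspace_Q) blast
  show "closed_form T" by (rule closed_T)
  show "T |` dom Q \<subseteq>\<^sub>m T" by (auto simp: map_le_def)
  show "densely_defined (T |` dom Q)" using dense dom_restrict_T by (simp add: densely_defined_def)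
  show "dom (T |` dom Q) = dom Q" by (rule dom_restrict_T)
  show "the ((T |` dom Q) u) \<le> the (Q u)" if "u \<in> dom Q" for u using that T_le_Q(2) by simp
qed

theorem regular_part_eq: "regular_part Q = T |` dom Q"
  unfolding regular_part_def
proof (rule the_equality)
  show "minorant Q (T |` dom Q) \<and>
      (\<forall>S. minorant Q S \<longrightarrow> (\<forall>u\<in>dom Q. the (S u) \<le> the ((T |` dom Q) u)))"
    using minorant_T minorant_le_T by simp
  fix R assume R: "minorant Q R \<and> (\<forall>S. minorant Q S \<longrightarrow> (\<forall>u\<in>dom Q. the (S u) \<le> the (R u)))"
  have dom: "dom R = dom Q" using R by (simp add: minorant_def)
  show "R = T |` dom Q"
  proof
    fix u
    show "R u = (T |` dom Q) u"
    proof (cases "u \<in> dom Q")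
      case True
      have "the (R u) = the (T u)"
      proof (rule antisym)
        show "the (R u) \<le> the (T u)" using R True by (intro minorant_le_T) auto
        have "the ((T |` dom Q) u) \<le> the (R u)" using R minorant_T True by blast
        then show "the (T u) \<le> the (R u)" using True by simp
      qed
      moreover have "u \<in> dom R" "u \<in> dom T" using True dom T_le_Q(1) by auto
      ultimately show ?thesis using True by auto
    next
      case False
      then have "u \<notin> dom R" using dom by simp
      then show ?thesis using False by (simp add: restrict_map_def domIff)
    qed
  qed
qed

text \<open>
  Almost minimisers of the envelopes at \<open>f\<close>: the penalty \<open>(n + 1)\<parallel>v\<^sub>n - f\<parallel>\<^sup>2\<close> is bounded by \<open>T[f] + 1\<close>, which
  forces \<open>v\<^sub>n \<rightarrow> f\<close>.
\<close>

lemma recovery_sequence: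
  assumes f: "f \<in> dom T"
  obtains v where "\<And>n. v n \<in> dom Q" "v \<longlonglongrightarrow> f"
    "\<And>n. the (Q (v n)) \<le> the (T f) + inverse (real (Suc n))"
proof -
  have "\<exists>v\<in>dom Q. the (Q v) + real (Suc n) * (norm (v - f))\<^sup>2 < M n f + inverse (real (Suc n))" for n
    unfolding M_def by (rule moreau_envelope_approx[OF dom_Q_ne]) simp
  then obtain v where v: "\<And>n. v n \<in> dom Q"
    and less: "\<And>n. the (Q (v n)) + real (Suc n) * (norm (v n - f))\<^sup>2 < M n f + inverse (real (Suc n))"
    by metis
  have bound: "the (Q (v n)) + real (Suc n) * (norm (v n - f))\<^sup>2 \<le> the (T f) + inverse (real (Suc n))" for n
    using less[of n] M_le_T[OF f, of n] by linarith
  have "(norm (v n - f))\<^sup>2 \<le> (the (T f) + 1) * inverse (real (Suc n))" for n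
  proof -
    have "inverse (real (Suc n)) \<le> 1" by (simp add: field_simps)
    then have "real (Suc n) * (norm (v n - f))\<^sup>2 \<le> the (T f) + 1"
      using bound[of n] Q_nonneg[THEN bspec, OF v[of n]] by linarith
    then show ?thesis by (simp add: field_simps)
  qed
  then have "(\<lambda>n. (norm (v n - f))\<^sup>2) \<longlonglongrightarrow> 0"
    by (intro tendsto_zero_if_norm_le[OF _ tendsto_mult_right_zero[OF LIMSEQ_inverse_real_of_nat]]) auto
  then have "v \<longlonglongrightarrow> f" by (rule tendsto_if_norm_square_tendsto_zero)
  moreover have "the (Q (v n)) \<le> the (T f) + inverse (real (Suc n))" for n
  proof -
    have "0 \<le> real (Suc n) * (norm (v n - f))\<^sup>2" by simp
    then show ?thesis using bound[of n] by linarith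
  qed
  ultimately show ?thesis using that v by blast
qed

text \<open>
  By the parallelogram law \<open>T[v\<^sub>n - f] = 2 T[v\<^sub>n] + 2 T[f] - T[v\<^sub>n + f]\<close>. The first term is at most
  \<open>2 Q[v\<^sub>n]\<close>, hence asymptotically at most \<open>2 T[f]\<close>, and lower semicontinuity bounds the last term
  from below by \<open>4 T[f]\<close> in the limit.
\<close>

lemma recovery_sequence_converges:
  assumes f: "f \<in> dom T" and v: "\<And>n. v n \<in> dom Q" "v \<longlonglongrightarrow> f"
    and le: "\<And>n. the (Q (v n)) \<le> the (T f) + inverse (real (Suc n))"
  shows "(\<lambda>n. the (T (v n - f))) \<longlonglongrightarrow> 0"
proof (rule LIMSEQ_I)
  interpret semi_inner "dom T" "sesq T" by (rule positive_form_semi_inner[OF positive_T])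
  note val = quadratic_sesq[OF positive_T]
  fix e :: real assume e: "0 < e"
  have vT: "v n \<in> dom T" for n using v T_le_Q by blast
  \<comment> \<open>A single envelope that is close to \<open>T\<close> at \<open>f\<close>: being continuous and quadratic, it bounds
    \<open>T[v n + f]\<close> from below by almost \<open>4 T[f]\<close> for large \<open>n\<close>.\<close>
  have "\<forall>\<^sub>F k in sequentially. the (T f) - e / 16 < M k f"
    using order_tendstoD(1)[OF M_tendsto_T[OF f], of "the (T f) - e / 16"] e by simp
  then obtain k where k: "the (T f) - e / 16 < M k f" by (auto simp: eventually_sequentially)
  have M2: "M k (f + f) = 4 * M k f" using M_scale[of k 2 f] complex_vector.scale_left_distrib[of 1 1 f] by simp
  have lim: "(\<lambda>n. M k (v n + f)) \<longlonglongrightarrow> M k (f + f)"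
    by (intro M_tendsto tendsto_intros v(2))
  have "\<forall>\<^sub>F n in sequentially. 4 * the (T f) - e / 2 < M k (v n + f)"
    using order_tendstoD(1)[OF lim, of "4 * the (T f) - e / 2"] k M2 e by simp
  moreover have "\<forall>\<^sub>F n in sequentially. inverse (real (Suc n)) < e / 4"
    using order_tendstoD(2)[OF LIMSEQ_inverse_real_of_nat, of "e / 4"] e by simp
  ultimately have "\<forall>\<^sub>F n in sequentially. norm (the (T (v n - f)) - 0) < e"
  proof eventually_elim
    case (elim n)
    have "the (T (v n + f)) + the (T (v n - f)) = 2 * the (T (v n)) + 2 * the (T f)"
      using parallelogram[OF vT f, of n] vT[of n] f by (simp add: val mem)
    moreover have "M k (v n + f) \<le> the (T (v n + f))" by (rule M_le_T) (simp add: vT f mem)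
    moreover have "the (T (v n)) \<le> the (Q (v n))" by (rule T_le_Q(2)[OF v(1)])
    moreover have "0 \<le> the (T (v n - f))" by (rule positive_form_nonneg[OF positive_T]) (simp add: vT f mem)
    ultimately show ?case using elim le[of n] by (simp only: diff_0_right real_norm_def abs_of_nonneg)
  qed
  then show "\<exists>N. \<forall>n\<ge>N. norm (the (T (v n - f)) - 0) < e" by (simp add: eventually_sequentially)
qed

theorem form_closure_regular_part: "form_closure (regular_part Q) = T"
  unfolding regular_part_eq form_closure_def
proof (rule the_equality)
  have restrict: "T |` dom Q \<subseteq>\<^sub>m T" by (auto simp: map_le_def)
  have least: "T \<subseteq>\<^sub>m S" if S: "closed_form S" "T |` dom Q \<subseteq>\<^sub>m S" for S
    unfolding map_le_def
  proof
    fix f assume f: "f \<in> dom T"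
    obtain v where v: "\<And>n. v n \<in> dom Q" "v \<longlonglongrightarrow> f"
      and le: "\<And>n. the (Q (v n)) \<le> the (T f) + inverse (real (Suc n))"
      using recovery_sequence[OF f] by blast
    have eq: "S u = T u" if "u \<in> dom Q" for u
      using S(2) that dom_restrict_T by (simp add: map_le_def)
    have "S f = T f"
    proof (rule closed_form_extends_from_core[OF positive_T S(1)])
      show "v n \<in> dom T" for n using v T_le_Q by blast
      then show "v n \<in> dom S" for n using eq[OF v(1), of n] by (auto simp: dom_def)
      show "the (S (v m - v n)) = the (T (v m - v n))" for m n
        using eq positive_form_mem(2)[OF positive_Q v(1) v(1)] by simp
    qed (use eq v f recovery_sequence_converges[OF f v le] in simp_all)
    then show "T f = S f" by simp
  qed
  show "closed_form T \<and> T |` dom Q \<subseteq>\<^sub>m T \<and>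
      (\<forall>S. closed_form S \<and> T |` dom Q \<subseteq>\<^sub>m S \<longrightarrow> T \<subseteq>\<^sub>m S)"
    using closed_T least restrict by blast
  fix R assume R: "closed_form R \<and> T |` dom Q \<subseteq>\<^sub>m R \<and>
      (\<forall>S. closed_form S \<and> T |` dom Q \<subseteq>\<^sub>m S \<longrightarrow> R \<subseteq>\<^sub>m S)"
  have "R \<subseteq>\<^sub>m T" using R closed_T restrict by blast
  moreover have "T \<subseteq>\<^sub>m R" using R least by blast
  ultimately show "R = T" by (rule map_le_antisym)
qed

text \<open>
  Relaxing \<open>Q\<close> to \<open>T\<close> leaves the infimum unchanged: recovery sequences reach the value of \<open>T\<close> at each
  point of its domain.
\<close>

lemma moreau_envelope_T: "moreau_envelope T 1 g = moreau_envelope Q 1 g"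
proof (rule antisym)
  have T_nonneg: "\<forall>v\<in>dom T. 0 \<le> the (T v)" using positive_form_nonneg[OF positive_T] by blast
  show "moreau_envelope T 1 g \<le> moreau_envelope Q 1 g"
  proof (rule moreau_envelope_ge[OF dom_Q_ne])
    fix v assume v: "v \<in> dom Q"
    show "moreau_envelope T 1 g \<le> the (Q v) + 1 * (norm (v - g))\<^sup>2"
      using moreau_envelope_le[OF T_nonneg _ T_le_Q(1)[OF v], of 1 g] T_le_Q(2)[OF v] by simp
  qed
  show "moreau_envelope Q 1 g \<le> moreau_envelope T 1 g"
  proof (rule moreau_envelope_ge)
    fix f assume f: "f \<in> dom T"
    obtain v where v: "\<And>n. v n \<in> dom Q" "v \<longlonglongrightarrow> f"
      and le: "\<And>n. the (Q (v n)) \<le> the (T f) + inverse (real (Suc n))"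
      using recovery_sequence[OF f] by blast
    have "(\<lambda>n. the (T f) + inverse (real (Suc n)) + 1 * (norm (v n - g))\<^sup>2)
        \<longlonglongrightarrow> the (T f) + 0 + 1 * (norm (f - g))\<^sup>2"
      by (intro tendsto_intros LIMSEQ_inverse_real_of_nat v(2))
    moreover have "moreau_envelope Q 1 g \<le> the (T f) + inverse (real (Suc n)) + 1 * (norm (v n - g))\<^sup>2" for n
      using moreau_envelope_le[OF Q_nonneg _ v(1)[of n], of 1 g] le[of n] by linarith
    ultimately show "moreau_envelope Q 1 g \<le> the (T f) + 1 * (norm (f - g))\<^sup>2"
      using LIMSEQ_le_const by fastforce
  qed (use dense_T in \<open>auto simp: densely_defined_def\<close>)
qed

text \<open>
  The minimiser for \<open>q l\<close>, tested in the minimum problem of \<open>T\<close>, has at most the value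
  \<open>moreau_envelope (q l) 1 g\<close>, since \<open>T \<le> Q \<le> q l\<close>. The excess over the minimum tends to zero
  and bounds the squared distance from the minimiser for \<open>T\<close>.
\<close>

theorem prox_tendsto: "((\<lambda>l. prox (q l) 1 g) \<longlongrightarrow> prox T 1 g) (at_right 0)"
proof -
  have "norm (prox (q l) 1 g - prox T 1 g) \<le>
      sqrt (moreau_envelope (q l) 1 g - moreau_envelope Q 1 g)" if l: "0 < l" for l
  proof (rule real_le_rsqrt)
    define u where "u = prox (q l) 1 g"
    have u: "u \<in> dom Q" using prox_mem[OF q_closed[OF l], of 1 g] l by (simp add: u_def dom_q)
    have uT: "u - prox T 1 g \<in> dom T"
      by (intro positive_form_mem(2)[OF positive_T] T_le_Q(1)[OF u] prox_mem[OF closed_T]) simp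
    have "the (T u) + 1 * (norm (u - g))\<^sup>2 =
        moreau_envelope T 1 g + the (T (u - prox T 1 g)) + 1 * (norm (u - prox T 1 g))\<^sup>2"
      by (rule moreau_envelope_gap[OF closed_T _ T_le_Q(1)[OF u]]) simp
    moreover have "moreau_envelope (q l) 1 g = the (q l u) + 1 * (norm (u - g))\<^sup>2"
      unfolding u_def by (rule moreau_envelope_prox[OF q_closed[OF l]]) simp
    ultimately show "(norm (u - prox T 1 g))\<^sup>2 \<le> moreau_envelope (q l) 1 g - moreau_envelope Q 1 g"
      using q_ge[OF l u] T_le_Q(2)[OF u] positive_form_nonneg[OF positive_T uT] by (simp add: moreau_envelope_T)
  qed
  then have "\<forall>\<^sub>F l in at_right 0. norm (prox (q l) 1 g - prox T 1 g) \<le>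
      sqrt (moreau_envelope (q l) 1 g - moreau_envelope Q 1 g)"
    using eventually_at_right_less by (rule eventually_mono[rotated])
  moreover have "((\<lambda>l. sqrt (moreau_envelope (q l) 1 g - moreau_envelope Q 1 g)) \<longlongrightarrow> sqrt 0) (at_right 0)"
    by (intro tendsto_real_sqrt LIM_zero moreau_envelope_tendsto) simp
  ultimately have "((\<lambda>l. prox (q l) 1 g - prox T 1 g) \<longlongrightarrow> 0) (at_right 0)"
    unfolding real_sqrt_zero by (rule Lim_null_comparison)
  then show ?thesis by (rule LIM_zero_cancel)
qed

end


section \<open>The operator of a closed form\<close>

lemma form_operator_eq_Some_iff:
  assumes dense: "densely_defined S"
  shows "form_operator S u = Some f \<longleftrightarrow> u \<in> dom S \<and> (\<forall>v\<in>dom S. sesq S u v = cinner f v)"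
proof -
  have unique: "(THE f. \<forall>v\<in>dom S. sesq S u v = cinner f v) = f"
    if "\<forall>v\<in>dom S. sesq S u v = cinner f v" for f
  proof (rule the_equality)
    show "g = f" if g: "\<forall>v\<in>dom S. sesq S u v = cinner g v" for g
      by (rule eq_if_cinner_eq_on_dense[OF dense[unfolded densely_defined_def]])
        (use that \<open>\<forall>v\<in>dom S. sesq S u v = cinner f v\<close> in metis)
  qed (rule that)
  show ?thesis
  proof
    assume "form_operator S u = Some f"
    then have "u \<in> dom S \<and> (\<exists>f. \<forall>v\<in>dom S. sesq S u v = cinner f v)"
      and f: "f = (THE f. \<forall>v\<in>dom S. sesq S u v = cinner f v)"
      unfolding form_operator_def by (meson option.distinct(1), metis option.distinct(1) option.inject)
    then obtain g where u: "u \<in> dom S" and g: "\<forall>v\<in>dom S. sesq S u v = cinner g v" by blast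
    show "u \<in> dom S \<and> (\<forall>v\<in>dom S. sesq S u v = cinner f v)"
      unfolding f unique[OF g] using u g by blast
  next
    assume f: "u \<in> dom S \<and> (\<forall>v\<in>dom S. sesq S u v = cinner f v)"
    then have "u \<in> dom S \<and> (\<exists>f. \<forall>v\<in>dom S. sesq S u v = cinner f v)" by blast
    then show "form_operator S u = Some f"
      unfolding form_operator_def using unique[of f] f by simp
  qed
qed

locale closed_dense_form =
  fixes S :: "'a::complex_hilbert form"
  assumes closed: "closed_form S" and dense: "densely_defined S"
begin

abbreviation H :: "('a, 'a) operator" where "H \<equiv> form_operator S"

lemmas pos = closed_form_positive[OF closed]
lemmas H_iff = form_operator_eq_Some_iff[OF dense]

sublocale S: semi_inner "dom S" "sesq S"
  by (rule positive_form_semi_inner[OF pos])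

lemma dom_HE:
  assumes "u \<in> dom H"
  obtains f where "H u = Some f" "u \<in> dom S" "\<And>v. v \<in> dom S \<Longrightarrow> sesq S u v = cinner f v"
  using assms H_iff by blast

lemma sesq_H: "u \<in> dom H \<Longrightarrow> v \<in> dom S \<Longrightarrow> sesq S u v = cinner (the (H u)) v"
  by (erule dom_HE) simp

lemma dom_HD: "u \<in> dom H \<Longrightarrow> u \<in> dom S"
  by (erule dom_HE)

lemma dom_H_sub: "dom H \<subseteq> dom S"
  using dom_HD by blast

lemma H_prox: "H (prox S 1 g) = Some (g - prox S 1 g)"
  using prox_mem[OF closed, of 1 g] shift_sesq_prox[OF closed, of 1 _ g]
  by (simp add: H_iff shift_sesq_def hilbert.diff_left eq_diff_eq)

lemma prox_unique:
  assumes u: "u \<in> dom H"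
  shows "prox S 1 (the (H u) + u) = u"
  by (rule prox_eqI[OF closed])
    (use u in \<open>simp_all add: dom_HD shift_sesq_def sesq_H hilbert.add_left\<close>)

lemma resolvent1_H: "resolvent1 H g = prox S 1 g"
  unfolding resolvent1_def
proof (rule the_equality)
  show "prox S 1 g \<in> dom H \<and> the (H (prox S 1 g)) + prox S 1 g = g"
    using H_prox[of g] by auto
  show "u = prox S 1 g" if "u \<in> dom H \<and> the (H u) + u = g" for u
    using prox_unique[of u] that by simp
qed

lemma linear_H: "linear_operator H"
proof -
  have add: "H (u + v) = Some (the (H u) + the (H v))" if "u \<in> dom H" "v \<in> dom H" for u v
    using that by (simp add: H_iff dom_HD S.expand hilbert.expand sesq_H)
  have scale: "H (c *\<^sub>C u) = Some (c *\<^sub>C the (H u))" if "u \<in> dom H" for u c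
    using that by (simp add: H_iff dom_HD S.expand hilbert.expand sesq_H)
  have zero: "H 0 = Some 0"
    using S.scale_left[of 0 _ 0] S.zero_mem hilbert.scale_left[of 0 _ 0] by (auto simp: H_iff)
  show ?thesis
    unfolding linear_operator_def complex_vector.subspace_def
    using add scale zero by blast
qed

text \<open>
  The Riesz theorem on \<open>dom H\<close> gives the projection \<open>p\<close> of \<open>f\<close> onto the closure of \<open>dom H\<close> in the form
  norm. Then \<open>f - p\<close> is form-orthogonal to \<open>dom H\<close>, hence orthogonal in the Hilbert space to the
  range of \<open>H + 1\<close>, which is everything.
\<close>

lemma dom_H_core:
  assumes f: "f \<in> dom S"
  obtains x where "\<And>n::nat. x n \<in> dom H" "x \<longlonglongrightarrow> f" "(\<lambda>n. the (S (x n - f))) \<longlonglongrightarrow> 0"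
proof -
  interpret complete_inner "dom S" "shift_sesq S 1"
    by (rule shift_sesq_complete[OF closed]) simp
  have sub: "complex_vector.subspace (dom H)" using linear_H by (simp add: linear_operator_def)
  have HS: "u \<in> dom S" if "u \<in> dom H" for u using that dom_H_sub by blast
  obtain p x where p: "p \<in> dom S" and x: "\<And>n. x n \<in> dom H"
    and lim: "(\<lambda>n. nsq (x n - p)) \<longlonglongrightarrow> 0"
    and eq: "\<And>k. k \<in> dom H \<Longrightarrow> shift_sesq S 1 p k = shift_sesq S 1 f k"
    using Riesz_on_subspace[OF sub dom_H_sub, of "shift_sesq S 1 f" "nsq f"]
    by (auto simp: f HS expand Cauchy_Schwarz nsq_nonneg)
  define k where "k = prox S 1 (f - p)"
  have k: "k \<in> dom H" using H_prox[of "f - p"] by (auto simp: k_def)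
  have d: "f - p \<in> dom S" by (rule diff_mem[OF f p])
  have "cinner (f - p) (f - p) = shift_sesq S 1 k (f - p)"
    using shift_sesq_prox[OF closed _ d, of 1 "f - p"] by (simp add: k_def)
  also have "\<dots> = cnj (shift_sesq S 1 (f - p) k)"
    by (rule hermitian[OF d HS[OF k]])
  also have "\<dots> = 0"
    using eq[OF k] by (simp add: diff_left f p HS[OF k])
  finally have "f = p" by (simp add: cinner_self)
  show ?thesis
    by (rule that[OF x])
      (use norm_tendsto_if_shift_sesq_tendsto[OF pos _ HS[OF x] p lim] \<open>f = p\<close> in simp_all)
qed

lemma dense_H: "closure (dom H) = UNIV"
proof -
  have "dom S \<subseteq> closure (dom H)"
    using dom_H_core by (metis closure_sequential subsetI)
  then have "closure (dom S) \<subseteq> closure (dom H)" by (rule closure_minimal) simp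
  then show ?thesis using dense by (auto simp: densely_defined_def)
qed

lemma H_symmetric:
  assumes "u \<in> dom H" "v \<in> dom H"
  shows "cinner (the (H u)) v = cinner u (the (H v))"
  using S.hermitian[of v u] hilbert.hermitian[of "the (H v)" u] assms
  by (simp add: sesq_H dom_HD)

text \<open>
  If \<open>w\<close> is a candidate for the adjoint at \<open>v\<close>, the solution \<open>z\<close> of \<open>H z + z = w + v\<close> must be \<open>v\<close>:
  symmetry makes \<open>v - z\<close> orthogonal to the range of \<open>H + 1\<close>, which is everything.
\<close>

lemma op_adjoint_H: "op_adjoint H = H"
proof
  fix v
  have symm: "\<forall>u\<in>dom H. cinner (the (H u)) v = cinner u f" if "H v = Some f" for f
    using H_symmetric[of _ v] that by auto
  have adj: "H v = Some w" if w: "\<forall>u\<in>dom H. cinner (the (H u)) v = cinner u w" for w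
  proof -
    define z where "z = prox S 1 (w + v)"
    have z: "H z = Some (w + v - z)" unfolding z_def by (rule H_prox)
    \<comment> \<open>The vector \<open>k\<close> solves \<open>H k + k = v - z\<close>.\<close>
    define k where "k = prox S 1 (v - z)"
    have k: "H k = Some (v - z - k)" unfolding k_def by (rule H_prox)
    have kz: "cinner (v - z - k) z = cinner k (w + v - z)"
      using H_symmetric[of k z] k z by auto
    have kv: "cinner (v - z - k) v = cinner k w" using w k by force
    have "cinner (v - z) (v - z) = cinner (v - z - k) v + cinner k v - cinner (v - z - k) z - cinner k z"
      by (simp add: hilbert.expand)
    also have "\<dots> = 0" unfolding kv kz by (simp add: hilbert.expand)
    finally have "v = z" by (simp add: cinner_self)
    then show ?thesis using z by simp
  qed
  show "op_adjoint H v = H v"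
  proof (cases "\<exists>w. \<forall>u\<in>dom H. cinner (the (H u)) v = cinner u w")
    case True
    then obtain w where w: "\<forall>u\<in>dom H. cinner (the (H u)) v = cinner u w" by blast
    have "(THE w. \<forall>u\<in>dom H. cinner (the (H u)) v = cinner u w) = w"
    proof (rule the_equality)
      fix w' assume "\<forall>u\<in>dom H. cinner (the (H u)) v = cinner u w'"
      then show "w' = w" using adj[OF w] adj[of w'] by simp
    qed (rule w)
    then show ?thesis unfolding op_adjoint_def using True adj[OF w] by simp
  next
    case False
    then have "H v = None" using symm by (cases "H v") blast+
    then show ?thesis unfolding op_adjoint_def using False by simp
  qed
qed

lemma S_eq_cinner_H: "u \<in> dom H \<Longrightarrow> the (S u) = Re (cinner (the (H u)) u)"
  using quadratic_sesq[OF pos, of u] sesq_H[of u u] by (simp add: quadratic_def dom_HD)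

theorem positive_selfadjoint_H: "positive_selfadjoint H"
  unfolding positive_selfadjoint_def
proof (intro conjI ballI linear_H dense_H op_adjoint_H)
  show "0 \<le> Re (cinner (the (H u)) u)" if "u \<in> dom H" for u
    using positive_form_nonneg[OF pos dom_HD[OF that]] S_eq_cinner_H[OF that] by simp
qed

text \<open>
  Positivity makes \<open>A + 1\<close> injective, so that \<open>resolvent1 A\<close> maps \<open>A u + u\<close> to \<open>u\<close>; as it is also the
  resolvent of \<open>H\<close>, this gives \<open>A \<subseteq> H\<close>. A symmetric extension of a self-adjoint operator is that
  operator.
\<close>

theorem eq_H_if_resolvent1_eq:
  assumes A: "positive_selfadjoint A" and res: "\<And>g. resolvent1 A g = resolvent1 H g"
  shows "A = H"
proof -
  have lin: "linear_operator A" and adj: "op_adjoint A = A"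
    and nonneg: "\<And>u. u \<in> dom A \<Longrightarrow> 0 \<le> Re (cinner (the (A u)) u)"
    using A by (auto simp: positive_selfadjoint_def)
  have A_diff: "u - w \<in> dom A \<and> the (A (u - w)) = the (A u) - the (A w)"
    if "u \<in> dom A" "w \<in> dom A" for u w
  proof -
    have sub: "complex_vector.subspace (dom A)" using lin by (simp add: linear_operator_def)
    have d: "u - w \<in> dom A" by (rule complex_vector.subspace_diff[OF sub that])
    have "A ((u - w) + w) = Some (the (A (u - w)) + the (A w))"
      using lin d that unfolding linear_operator_def by blast
    then show ?thesis using d by simp
  qed
  have A_le_H: "H u = A u" if u: "u \<in> dom A" for u
  proof -
    have "resolvent1 A (the (A u) + u) = u"
      unfolding resolvent1_def
    proof (rule the_equality)
      fix w assume w: "w \<in> dom A \<and> the (A w) + w = the (A u) + u"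
      define d where "d = w - u"
      have d: "d \<in> dom A" "the (A d) = - d"
        using A_diff[of w u] u w by (auto simp: d_def algebra_simps)
      have "0 \<le> - (norm d)\<^sup>2"
        using nonneg[OF d(1)] hilbert.scale_left[of d d "-1"] d(2) by (simp add: cinner_self del: of_real_power)
      then show "w = u" by (simp add: d_def)
    qed (use u in simp)
    then have eq: "prox S 1 (the (A u) + u) = u" by (simp add: res resolvent1_H)
    show ?thesis using H_prox[of "the (A u) + u"] u unfolding eq by auto
  qed
  have "u \<in> dom A" if u: "u \<in> dom H" for u
  proof -
    have "\<forall>v\<in>dom A. cinner (the (A v)) u = cinner v (the (H u))"
    proof
      fix v assume v: "v \<in> dom A"
      then have "v \<in> dom H" unfolding domIff A_le_H[OF v] .
      from H_symmetric[OF this u] show "cinner (the (A v)) u = cinner v (the (H u))"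
        by (simp add: A_le_H[OF v])
    qed
    then have "op_adjoint A u \<noteq> None" unfolding op_adjoint_def by auto
    then show ?thesis by (simp add: adj domIff)
  qed
  then have "dom H \<subseteq> dom A" by blast
  then show "A = H"
    using A_le_H by (intro map_le_antisym) (auto simp: map_le_def)
qed

text \<open>
  On the domain of the operator both forms equal \<open>Re \<langle>H u, u\<rangle>\<close>, and this domain is a core of each.
\<close>

theorem form_operator_inject:
  assumes "closed_form R" "densely_defined R" and eq: "form_operator R = H"
  shows "R = S"
proof -
  interpret R: closed_dense_form R by unfold_locales fact+
  have val: "the (S u) = the (R u)" if "u \<in> dom H" for u
    using S_eq_cinner_H[OF that] R.S_eq_cinner_H[of u] that by (simp add: eq)
  have sub: "complex_vector.subspace (dom H)" using linear_H by (simp add: linear_operator_def)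
  note diff = complex_vector.subspace_diff[OF sub]
  have HS: "u \<in> dom S" "u \<in> dom R" if "u \<in> dom H" for u
    using that dom_HD R.dom_HD by (simp_all add: eq)
  show ?thesis
  proof (rule map_le_antisym)
    show "S \<subseteq>\<^sub>m R"
      unfolding map_le_def
    proof
      fix f assume f: "f \<in> dom S"
      obtain x where x: "\<And>n. x n \<in> dom H" "x \<longlonglongrightarrow> f" "(\<lambda>n. the (S (x n - f))) \<longlonglongrightarrow> 0"
        using dom_H_core[OF f] by blast
      have "R f = S f"
        by (rule closed_form_extends_from_core[OF pos R.closed HS(1)[OF x(1)] x(2) f x(3) HS(2)[OF x(1)]])
          (simp_all add: val x diff)
      then show "S f = R f" by simp
    qed
    show "R \<subseteq>\<^sub>m S"
      unfolding map_le_def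
    proof
      fix f assume f: "f \<in> dom R"
      obtain x where x: "\<And>n. x n \<in> dom H" "x \<longlonglongrightarrow> f" "(\<lambda>n. the (R (x n - f))) \<longlonglongrightarrow> 0"
        using R.dom_H_core[OF f] unfolding eq by blast
      have "S f = R f"
        by (rule closed_form_extends_from_core[OF R.pos closed HS(2)[OF x(1)] x(2) f x(3) HS(1)[OF x(1)]])
          (simp_all add: val x diff)
      then show "R f = S f" by simp
    qed
  qed
qed

end


section \<open>The approximating traces\<close>

locale trace_setting =
  fixes E :: "'h::complex_hilbert form"
    and J :: "('h, 'aux::complex_hilbert) operator"
  assumes closed: "closed_form E"
    and linear: "linear_operator J"
    and dom_J: "dom J \<subseteq> dom E"
    and dense_ran: "closure (ran J) = UNIV"
    and J_closed: "form_closed_operator E J"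
begin

lemmas pos = closed_form_positive[OF closed]

sublocale E: semi_inner "dom E" "sesq E"
  by (rule positive_form_semi_inner[OF pos])

lemma J_mem: "u \<in> dom J \<Longrightarrow> u \<in> dom E"
  using dom_J by blast

lemma subspace_dom_J: "complex_vector.subspace (dom J)"
  using linear by (simp add: linear_operator_def)

lemma J_add: "J u = Some f \<Longrightarrow> J v = Some g \<Longrightarrow> J (u + v) = Some (f + g)"
  and J_scale: "J u = Some f \<Longrightarrow> J (c *\<^sub>C u) = Some (c *\<^sub>C f)"
  using linear domI unfolding linear_operator_def by (metis option.sel)+

lemma J_diff: "J u = Some f \<Longrightarrow> J v = Some g \<Longrightarrow> J (u - v) = Some (f - g)"
  using J_add[of u f "(-1) *\<^sub>C v" "(-1) *\<^sub>C g"] J_scale[of v g "-1"] by simp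

lemma J_zero: "J 0 = Some 0"
proof -
  obtain f where "J 0 = Some f" using complex_vector.subspace_0[OF subspace_dom_J] by blast
  from J_scale[OF this, of 0] show ?thesis by simp
qed

lemma kernelD: "k \<in> kernel J \<Longrightarrow> J k = Some 0"
  by (simp add: kernel_def)

lemma kernel_mem: "k \<in> kernel J \<Longrightarrow> k \<in> dom E"
  using J_mem by (auto simp: kernel_def)

lemma subspace_kernel: "complex_vector.subspace (kernel J)"
  using J_zero J_add[of _ 0 _ 0] J_scale[of _ 0]
  by (auto simp: complex_vector.subspace_def kernel_def)

lemma J_closedD:
  assumes "\<And>n. x n \<in> dom J" "u \<in> dom E" "l > 0"
    "(\<lambda>n. quadratic (shift_sesq E l) (x n - u)) \<longlonglongrightarrow> 0" "(\<lambda>n. the (J (x n))) \<longlonglongrightarrow> f"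
  shows "J u = Some f"
proof -
  have xE: "x n \<in> dom E" for n using assms J_mem by blast
  note lim = norm_tendsto_if_shift_sesq_tendsto[OF pos assms(3) xE assms(2) assms(4)]
  have "(\<lambda>n. the (E (x n - u)) + 1 * (norm (x n - u))\<^sup>2) \<longlonglongrightarrow> 0 + 1 * 0\<^sup>2"
    by (intro tendsto_intros lim(2) tendsto_norm_zero[OF LIM_zero[OF lim(1)]])
  then have "(\<lambda>n. the (shift_form E 1 (x n - u))) \<longlonglongrightarrow> 0"
    using xE assms(2) by (simp add: the_shift_form E.mem)
  then show ?thesis using J_closed assms unfolding form_closed_operator_def by blast
qed

text \<open>
  Subtract from \<open>u\<close> its projection onto \<open>kernel J\<close>, which is closed in the form norm because \<open>J\<close> is a
  closed operator.
\<close>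

lemma orthogonal_lift_exists:
  assumes l: "0 < l" and u: "J u = Some f"
  shows "\<exists>w. J w = Some f \<and> (\<forall>k\<in>kernel J. shift_sesq E l w k = 0)"
proof -
  interpret complete_inner "dom E" "shift_sesq E l" by (rule shift_sesq_complete[OF closed l])
  have uE: "u \<in> dom E" using u J_mem by blast
  have sub: "kernel J \<subseteq> dom E" using kernel_mem by blast
  obtain p x where p: "p \<in> dom E" and x: "\<And>n. x n \<in> kernel J"
    and lim: "(\<lambda>n. nsq (x n - p)) \<longlonglongrightarrow> 0"
    and eq: "\<And>k. k \<in> kernel J \<Longrightarrow> shift_sesq E l p k = shift_sesq E l u k"
    using Riesz_on_subspace[OF subspace_kernel sub, of "shift_sesq E l u" "nsq u"]
    by (auto simp: uE kernel_mem expand Cauchy_Schwarz nsq_nonneg)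
  have "J p = Some 0"
    by (rule J_closedD[OF _ p l lim]) (use kernelD[OF x] in auto)
  then have "J (u - p) = Some f" using J_diff[OF u] by fastforce
  moreover have "\<forall>k\<in>kernel J. shift_sesq E l (u - p) k = 0"
    using eq uE p by (simp add: diff_left kernel_mem)
  ultimately show ?thesis by blast
qed

lemma orthogonal_lift_unique:
  assumes l: "0 < l" and w: "J w = Some f" "\<forall>k\<in>kernel J. shift_sesq E l w k = 0"
    and w': "J w' = Some f" "\<forall>k\<in>kernel J. shift_sesq E l w' k = 0"
  shows "w = w'"
proof -
  interpret semi_inner "dom E" "shift_sesq E l" using shift_sesq_semi_inner[OF pos] l by simp
  have E: "w \<in> dom E" "w' \<in> dom E" using w w' J_mem by blast+
  have d: "w - w' \<in> kernel J" using J_diff[OF w(1) w'(1)] by (simp add: kernel_def)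
  have "nsq (w - w') = 0"
    using w w' d E kernel_mem[OF d] by (simp add: quadratic_def diff_left)
  then have "l * (norm (w - w'))\<^sup>2 \<le> 0"
    using positive_form_nonneg[OF pos kernel_mem[OF d]] by (simp add: quadratic_shift_sesq[OF pos kernel_mem[OF d]])
  then show ?thesis using l by (simp add: mult_le_0_iff)
qed

text \<open>
  The element of least shifted energy in the fibre of \<open>J\<close> over \<open>f\<close>, characterised by orthogonality to
  \<open>kernel J\<close>.
\<close>

definition lift :: "real \<Rightarrow> 'aux \<Rightarrow> 'h"
  where "lift l f = (THE w. J w = Some f \<and> (\<forall>k\<in>kernel J. shift_sesq E l w k = 0))"

lemma lift_eqI:
  assumes "0 < l" "J w = Some f" "\<And>k. k \<in> kernel J \<Longrightarrow> shift_sesq E l w k = 0"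
  shows "lift l f = w"
  unfolding lift_def
proof (rule the_equality)
  show w: "J w = Some f \<and> (\<forall>k\<in>kernel J. shift_sesq E l w k = 0)" using assms by simp
  show "w' = w" if "J w' = Some f \<and> (\<forall>k\<in>kernel J. shift_sesq E l w' k = 0)" for w'
    using that w by (intro orthogonal_lift_unique[OF assms(1), of w' f w]) simp_all
qed

lemma lift:
  assumes l: "0 < l" and f: "f \<in> ran J"
  shows J_lift: "J (lift l f) = Some f"
    and lift_orth: "k \<in> kernel J \<Longrightarrow> shift_sesq E l (lift l f) k = 0"
    and lift_mem: "lift l f \<in> dom E"
proof -
  obtain u where "J u = Some f" using f by (auto simp: ran_def)
  from orthogonal_lift_exists[OF l this] obtain w
    where w: "J w = Some f" "\<forall>k\<in>kernel J. shift_sesq E l w k = 0" by blast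
  have "lift l f = w" by (rule lift_eqI[OF l w(1)]) (use w(2) in blast)
  then show "J (lift l f) = Some f" "k \<in> kernel J \<Longrightarrow> shift_sesq E l (lift l f) k = 0"
    using w by simp_all
  then show "lift l f \<in> dom E" using J_mem by blast
qed

text \<open>
  The projection of \<open>u\<close> depends on \<open>J u\<close> only. This is what makes the approximating trace well defined.
\<close>

lemma trace_proj_eq_lift:
  assumes l: "0 < l" and u: "J u = Some f"
  shows "trace_proj E J l u = lift l f"
proof -
  interpret semi_inner "dom E" "shift_sesq E l" using shift_sesq_semi_inner[OF pos] l by simp
  have f: "f \<in> ran J" using u by (auto simp: ran_def)
  have uE: "u \<in> dom E" using u J_mem by blast
  note w = lift[OF l f]
  have sesq: "sesq (shift_form E l) v w = shift_sesq E l v w" if "v \<in> dom E" "w \<in> dom E" for v w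
    using that l by (intro sesq_shift_form[OF pos]) simp_all
  let ?N = "orth_complement (shift_form E l) (kernel J)"
  have N: "v \<in> ?N \<longleftrightarrow> v \<in> dom E \<and> (\<forall>k\<in>kernel J. shift_sesq E l v k = 0)" for v
    by (simp add: orth_complement_def dom_shift_form sesq kernel_mem cong: conj_cong)
  have k: "u - lift l f \<in> kernel J" using J_diff[OF u w(1)] by (simp add: kernel_def)
  have orth: "sesq (shift_form E l) (u - lift l f) m = 0" if m: "m \<in> ?N" for m
    using m hermitian[of m "u - lift l f"] k by (simp add: N sesq kernel_mem)
  show ?thesis
    unfolding trace_proj_def orth_projection_def
  proof (rule the_equality)
    show "lift l f \<in> ?N \<and> (\<forall>m\<in>?N. sesq (shift_form E l) (u - lift l f) m = 0)"
      using w orth by (simp add: N)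
    fix v assume v: "v \<in> ?N \<and> (\<forall>m\<in>?N. sesq (shift_form E l) (u - v) m = 0)"
    define d where "d = v - lift l f"
    have vE: "v \<in> dom E" using v by (simp add: N)
    have dE: "d \<in> dom E" using vE w by (simp add: d_def mem)
    have d: "d \<in> ?N" using v w by (simp add: N d_def mem diff_left kernel_mem)
    have "shift_sesq E l (u - lift l f) d - shift_sesq E l (u - v) d = 0"
    proof -
      have "sesq (shift_form E l) (u - v) d = 0" using v d by blast
      then show ?thesis using orth[OF d] uE vE w dE by (simp add: sesq mem)
    qed
    then have "nsq d = 0" using uE vE w dE by (simp add: d_def quadratic_def diff_left mem)
    then have "l * (norm d)\<^sup>2 \<le> 0"
      using positive_form_nonneg[OF pos dE] by (simp add: quadratic_shift_sesq[OF pos dE])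
    then show "v = lift l f" using l by (simp add: mult_le_0_iff d_def)
  qed
qed

lemma the_approx_trace:
  assumes l: "0 < l" and f: "f \<in> ran J"
  shows "the (approx_trace E J l f) = quadratic (shift_sesq E l) (lift l f)"
proof -
  have val: "the (shift_form E l (trace_proj E J l u)) = quadratic (shift_sesq E l) (lift l f)"
    if "J u = Some f" for u
    using lift_mem[OF l f] by (simp add: trace_proj_eq_lift[OF l that] the_shift_form quadratic_shift_sesq[OF pos])
  obtain u where u: "J u = Some f" using f by (auto simp: ran_def)
  have "(THE r. \<exists>u. J u = Some f \<and> r = the (shift_form E l (trace_proj E J l u))) =
      quadratic (shift_sesq E l) (lift l f)"
    by (rule the_equality) (use u val in auto)
  then show ?thesis using f by (simp add: approx_trace_def)
qed

lemma dom_approx_trace: "dom (approx_trace E J l) = ran J"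
  by (auto simp: approx_trace_def dom_def)

lemma subspace_ran: "complex_vector.subspace (ran J)"
  unfolding complex_vector.subspace_def ran_def using J_zero J_add J_scale by blast

lemma lift_linear:
  assumes l: "0 < l" and f: "f \<in> ran J" and g: "g \<in> ran J"
  shows lift_add: "lift l (f + g) = lift l f + lift l g"
    and lift_diff: "lift l (f - g) = lift l f - lift l g"
    and lift_scale: "lift l (c *\<^sub>C f) = c *\<^sub>C lift l f"
proof -
  interpret semi_inner "dom E" "shift_sesq E l" using shift_sesq_semi_inner[OF pos] l by simp
  note lift = J_lift[OF l] lift_orth[OF l] lift_mem[OF l] kernel_mem f g
  show "lift l (f + g) = lift l f + lift l g"
    by (rule lift_eqI[OF l]) (simp_all add: lift J_add add_left)
  show "lift l (f - g) = lift l f - lift l g"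
    by (rule lift_eqI[OF l]) (simp_all add: lift J_diff diff_left)
  show "lift l (c *\<^sub>C f) = c *\<^sub>C lift l f"
    by (rule lift_eqI[OF l]) (simp_all add: lift J_scale scale_left)
qed

text \<open>
  The map \<open>lift l\<close> is an isometry from \<open>approx_trace E J l\<close> into the shifted form of \<open>E\<close>, which is
  complete; closedness of \<open>J\<close> identifies the limit of the lifts with the lift of the limit.
\<close>

theorem closed_approx_trace:
  assumes l: "0 < l"
  shows "closed_form (approx_trace E J l)"
  unfolding closed_form_def
proof (intro conjI allI impI)
  interpret complete_inner "dom E" "shift_sesq E l" by (rule shift_sesq_complete[OF closed l])
  note mem_l = lift_mem[OF l]
  show "positive_form (approx_trace E J l)"
  proof (rule positive_formI(1))
    show "semi_inner (ran J) (\<lambda>f g. shift_sesq E l (lift l f) (lift l g))"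
    proof
      show "sesquilinear_on (ran J) (\<lambda>f g. shift_sesq E l (lift l f) (lift l g))"
        unfolding sesquilinear_on_def by (simp add: lift_add[OF l] lift_scale[OF l] expand mem_l)
    qed (simp_all add: subspace_ran diag_real diag_nonneg mem_l)
    show "dom (approx_trace E J l) = ran J" by (rule dom_approx_trace)
    show "the (approx_trace E J l f) = quadratic (\<lambda>f g. shift_sesq E l (lift l f) (lift l g)) f"
      if "f \<in> ran J" for f
      using that by (simp add: the_approx_trace[OF l] quadratic_def)
  qed
  fix y f
  assume "(\<forall>n. y n \<in> dom (approx_trace E J l)) \<and> y \<longlonglongrightarrow> f \<and>
    (\<forall>e>0. \<exists>N. \<forall>m\<ge>N. \<forall>n\<ge>N. the (approx_trace E J l (y m - y n)) < e)"
  then have y: "\<And>n. y n \<in> ran J" and lim_y: "y \<longlonglongrightarrow> f"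
    and cauchy: "\<And>e. 0 < e \<Longrightarrow> \<exists>N. \<forall>m\<ge>N. \<forall>n\<ge>N. the (approx_trace E J l (y m - y n)) < e"
    by (auto simp: dom_approx_trace)
  have val: "the (approx_trace E J l (g - h)) = nsq (lift l g - lift l h)"
    if "g \<in> ran J" "h \<in> ran J" for g h
    using that complex_vector.subspace_diff[OF subspace_ran that]
    by (simp add: the_approx_trace[OF l] lift_diff[OF l])
  obtain w where w: "w \<in> dom E" and lim: "(\<lambda>n. nsq (lift l (y n) - w)) \<longlonglongrightarrow> 0"
    using complete[of "\<lambda>n. lift l (y n)"] cauchy y by (auto simp: val mem_l)
  have Jw: "J w = Some f"
    by (rule J_closedD[OF _ w l lim]) (use J_lift[OF l y] lim_y in auto)
  have "shift_sesq E l w k = 0" if k: "k \<in> kernel J" for k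
    using s_tendsto[OF mem_l[OF y] w kernel_mem[OF k] lim] lift_orth[OF l y k] by (simp add: LIMSEQ_const_iff)
  then have lift_f: "lift l f = w" by (rule lift_eqI[OF l Jw])
  show f: "f \<in> dom (approx_trace E J l)" using Jw by (auto simp: dom_approx_trace ran_def)
  then show "(\<lambda>n. the (approx_trace E J l (y n - f))) \<longlonglongrightarrow> 0"
    using lim y by (simp add: val dom_approx_trace lift_f)
qed

end


section \<open>The trace form in the harmonic case\<close>

locale harmonic_setting = trace_setting +
  assumes dom_J_eq: "dom J = {h + k |h k. h \<in> harmonic_space E J \<and> k \<in> kernel J}"
    and harmonic_kernel: "harmonic_space E J \<inter> kernel J = {0}"
begin

lemma harmonic_proj:
  assumes u: "J u = Some f"
  shows "harmonic_proj E J u \<in> harmonic_space E J" "J (harmonic_proj E J u) = Some f"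
proof -
  obtain h k where hk: "u = h + k" "h \<in> harmonic_space E J" "k \<in> kernel J"
    using u dom_J_eq by blast
  have "harmonic_proj E J u = h"
    unfolding harmonic_proj_def
  proof (rule the_equality)
    show "h \<in> harmonic_space E J \<and> u - h \<in> kernel J" using hk by simp
    fix h' assume h': "h' \<in> harmonic_space E J \<and> u - h' \<in> kernel J"
    have "(u - h) - (u - h') \<in> kernel J"
      by (rule complex_vector.subspace_diff[OF subspace_kernel]) (use hk h' in simp_all)
    moreover have "h' - h \<in> harmonic_space E J"
      using h' hk complex_vector.subspace_diff[OF subspace_dom_J]
      by (auto simp: harmonic_space_def E.diff_left J_mem kernel_mem)
    ultimately have "h' - h \<in> harmonic_space E J \<inter> kernel J" by simp
    then show "h' = h" unfolding harmonic_kernel by simp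
  qed
  moreover have "J (u - k) = Some (f - 0)" by (rule J_diff[OF u kernelD[OF hk(3)]])
  ultimately show "harmonic_proj E J u \<in> harmonic_space E J" "J (harmonic_proj E J u) = Some f"
    using hk by simp_all
qed

lemma harmonic_form_eq:
  assumes h: "h \<in> harmonic_space E J" "J h = Some f"
  shows "harmonic_form E J f = Some (the (E h))"
proof -
  have eq: "harmonic_proj E J u = h" if u: "J u = Some f" for u
  proof -
    have "harmonic_proj E J u - h \<in> kernel J"
      using J_diff[OF harmonic_proj(2)[OF u] h(2)] by (simp add: kernel_def)
    moreover have "harmonic_proj E J u - h \<in> harmonic_space E J"
      using h(1) harmonic_proj(1)[OF u] complex_vector.subspace_diff[OF subspace_dom_J]
      by (auto simp: harmonic_space_def E.diff_left J_mem kernel_mem)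
    ultimately have "harmonic_proj E J u - h \<in> harmonic_space E J \<inter> kernel J" by simp
    then show ?thesis unfolding harmonic_kernel by simp
  qed
  have "(THE r. \<exists>u. J u = Some f \<and> r = the (E (harmonic_proj E J u))) = the (E h)"
    by (rule the_equality) (use h eq in auto)
  then show ?thesis using h by (auto simp: harmonic_form_def ran_def)
qed

lemma dom_harmonic_form: "dom (harmonic_form E J) = ran J"
  by (auto simp: harmonic_form_def dom_def)

text \<open>
  In the fibre over \<open>f\<close>, the harmonic element \<open>h\<close> minimises \<open>E\<close> and \<open>lift l f\<close> minimises
  \<open>E + l\<parallel>\<cdot>\<parallel>\<^sup>2\<close>; compare them in both minimum problems. The constant is \<open>C = \<parallel>h\<parallel>\<^sup>2\<close>.
\<close>

lemma harmonic_form_bounds: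
  assumes f: "f \<in> ran J"
  obtains C where "\<And>l. 0 < l \<Longrightarrow> the (harmonic_form E J f) \<le> the (approx_trace E J l f)"
    "\<And>l. 0 < l \<Longrightarrow> the (approx_trace E J l f) \<le> the (harmonic_form E J f) + l * C"
proof -
  obtain u where u: "J u = Some f" using f by (auto simp: ran_def)
  define h where "h = harmonic_proj E J u"
  have h: "h \<in> harmonic_space E J" "J h = Some f" unfolding h_def using harmonic_proj[OF u] by auto
  have hE: "h \<in> dom E" using h(2) J_mem by blast
  have val: "the (harmonic_form E J f) = the (E h)" by (simp add: harmonic_form_eq[OF h])
  have lower: "the (harmonic_form E J f) \<le> the (approx_trace E J l f)" if l: "0 < l" for l
  proof -
    define w where "w = lift l f"
    have w: "J w = Some f" "w \<in> dom E" unfolding w_def using lift[OF l f] by auto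
    have d: "w - h \<in> kernel J" using J_diff[OF w(1) h(2)] by (simp add: kernel_def)
    have "the (E (h + (w - h))) = the (E h) + the (E (w - h))"
      using E.nsq_add[OF hE kernel_mem[OF d]] h(1) d kernel_mem[OF d] hE
      by (simp add: quadratic_sesq[OF pos] E.mem harmonic_space_def w)
    then have "the (E h) \<le> the (E w)" using positive_form_nonneg[OF pos kernel_mem[OF d]] by simp
    also have "\<dots> \<le> the (approx_trace E J l f)"
      using l w by (simp add: the_approx_trace[OF l f] quadratic_shift_sesq[OF pos] flip: w_def)
    finally show ?thesis by (simp add: val)
  qed
  have upper: "the (approx_trace E J l f) \<le> the (harmonic_form E J f) + l * (norm h)\<^sup>2" if l: "0 < l" for l
  proof -
    interpret l: semi_inner "dom E" "shift_sesq E l" using shift_sesq_semi_inner[OF pos] l by simp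
    define w where "w = lift l f"
    have w: "J w = Some f" "w \<in> dom E" "\<And>k. k \<in> kernel J \<Longrightarrow> shift_sesq E l w k = 0"
      unfolding w_def using lift[OF l f] by auto
    have d: "h - w \<in> kernel J" using J_diff[OF h(2) w(1)] by (simp add: kernel_def)
    have "l.nsq (w + (h - w)) = l.nsq w + l.nsq (h - w)"
      using l.nsq_add[OF w(2) kernel_mem[OF d]] w(3)[OF d] by simp
    then have "l.nsq w \<le> l.nsq h" using l.nsq_nonneg[OF kernel_mem[OF d]] by simp
    then show ?thesis
      by (simp add: the_approx_trace[OF l f] val quadratic_shift_sesq[OF pos hE] flip: w_def)
  qed
  show ?thesis by (rule that[of "(norm h)\<^sup>2"]) (simp_all add: lower upper)
qed

sublocale approx: closed_approximation "harmonic_form E J" "approx_trace E J"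
proof
  show "closure (dom (harmonic_form E J)) = UNIV" by (simp add: dom_harmonic_form dense_ran)
  show "0 < l \<Longrightarrow> closed_form (approx_trace E J l)" for l by (rule closed_approx_trace)
  show "0 < l \<Longrightarrow> dom (approx_trace E J l) = dom (harmonic_form E J)" for l
    by (simp add: dom_harmonic_form dom_approx_trace)
  show "the (harmonic_form E J f) \<le> the (approx_trace E J l f)"
    if "0 < l" "f \<in> dom (harmonic_form E J)" for l f
    using that harmonic_form_bounds[of f] by (auto simp: dom_harmonic_form)
  fix f assume "f \<in> dom (harmonic_form E J)"
  then obtain C where b: "\<And>l. 0 < l \<Longrightarrow> the (harmonic_form E J f) \<le> the (approx_trace E J l f)"
    "\<And>l. 0 < l \<Longrightarrow> the (approx_trace E J l f) \<le> the (harmonic_form E J f) + l * C"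
    using harmonic_form_bounds[of f] by (auto simp: dom_harmonic_form)
  show "((\<lambda>l. the (approx_trace E J l f)) \<longlongrightarrow> the (harmonic_form E J f)) (at_right 0)"
  proof (rule tendsto_sandwich[where f = "\<lambda>_. the (harmonic_form E J f)"
        and h = "\<lambda>l. the (harmonic_form E J f) + l * C"])
    have "((\<lambda>l. the (harmonic_form E J f) + l * C)
        \<longlongrightarrow> the (harmonic_form E J f) + 0 * C) (at_right 0)"
      by (intro tendsto_intros)
    then show "((\<lambda>l. the (harmonic_form E J f) + l * C)
        \<longlongrightarrow> the (harmonic_form E J f)) (at_right 0)" by simp
    show "\<forall>\<^sub>F l in at_right 0. the (harmonic_form E J f) \<le> the (approx_trace E J l f)"
      using eventually_at_right_less by (rule eventually_mono) (rule b(1))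
    show "\<forall>\<^sub>F l in at_right 0. the (approx_trace E J l f) \<le> the (harmonic_form E J f) + l * C"
      using eventually_at_right_less by (rule eventually_mono) (rule b(2))
  qed simp
qed

sublocale limit: closed_dense_form "relaxation (harmonic_form E J)"
  by unfold_locales (rule approx.closed_T approx.dense_T)+

lemma resolvent_tendsto:
  "((\<lambda>l. resolvent1 (form_operator (approx_trace E J l)) g)
    \<longlongrightarrow> resolvent1 (form_operator (relaxation (harmonic_form E J))) g) (at_right 0)"
proof -
  have "prox (approx_trace E J l) 1 g = resolvent1 (form_operator (approx_trace E J l)) g"
    if l: "0 < l" for l
  proof -
    interpret closed_dense_form "approx_trace E J l"
      by unfold_locales (simp_all add: closed_approx_trace[OF l] densely_defined_def dom_approx_trace dense_ran)
    show ?thesis by (rule resolvent1_H[symmetric])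
  qed
  then have "\<forall>\<^sub>F l in at_right 0.
      prox (approx_trace E J l) 1 g = resolvent1 (form_operator (approx_trace E J l)) g"
    using eventually_at_right_less by (rule eventually_mono[rotated])
  from tendsto_cong[OF this] show ?thesis
    using approx.prox_tendsto[of g] by (simp add: limit.resolvent1_H)
qed

lemma trace_operator_eq: "trace_operator E J = form_operator (relaxation (harmonic_form E J))"
  unfolding trace_operator_def
proof (rule the_equality)
  show "positive_selfadjoint (form_operator (relaxation (harmonic_form E J))) \<and>
    (\<forall>g. ((\<lambda>l. resolvent1 (form_operator (approx_trace E J l)) g)
      \<longlongrightarrow> resolvent1 (form_operator (relaxation (harmonic_form E J))) g) (at_right 0))"
    using limit.positive_selfadjoint_H resolvent_tendsto by blast
  fix A assume A: "positive_selfadjoint A \<and>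
    (\<forall>g. ((\<lambda>l. resolvent1 (form_operator (approx_trace E J l)) g) \<longlongrightarrow> resolvent1 A g) (at_right 0))"
  have "resolvent1 A g = resolvent1 (form_operator (relaxation (harmonic_form E J))) g" for g
    using A resolvent_tendsto[of g] tendsto_unique[OF trivial_limit_at_right_real] by blast
  then show "A = form_operator (relaxation (harmonic_form E J))"
    using A by (intro limit.eq_H_if_resolvent1_eq) auto
qed

lemma trace_form_eq: "trace_form E J = relaxation (harmonic_form E J)"
  unfolding trace_form_def trace_operator_eq
  by (rule the_equality) (auto intro: limit.closed limit.dense limit.form_operator_inject)

end

theorem proposition3p3:
  fixes E :: "'h::complex_hilbert form"
    and J :: "('h, 'aux::complex_hilbert) operator"
  assumes "closed_form E"
    and "linear_operator J"
    and "dom J \<subseteq> dom E"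
    and "closure (ran J) = UNIV"
    and "form_closed_operator E J"
    and "dom J = {h + k |h k. h \<in> harmonic_space E J \<and> k \<in> kernel J}"
    and "harmonic_space E J \<inter> kernel J = {0}"
  shows "trace_form E J = form_closure (regular_part (harmonic_form E J))"
proof -
  interpret harmonic_setting E J by unfold_locales fact+
  show ?thesis unfolding trace_form_eq approx.form_closure_regular_part ..
qed

end
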